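(* Under the assumptions on $\mathcal Q$, $(\mathcal M,d)$, $q_{\mathcal A}$, $\overline D$ and $m$ listed in the context, and in particular assuming that for every $q\in\mathcal Q$ \[ \nabla_z\overline D(q,m(q))=0,\qquad G_q:=\nabla_z^2\overline D(q,m(q))\succ0, \] with the eigenvalues of $G_q$ bounded above and away from zero uniformly in $q$, and that \[ \eta(\varepsilon):=\inf\{\overline D(q,z): q\in\mathcal Q,\ z\in\mathcal M,\ d(z,m(q))\ge\varepsilon\}>0\quad\text{for every }\varepsilon>0, \] there are constants $0<c_D\le C_D<\infty$ such that, for all sufficiently large $k$, \[ c_D\,\rho_k(S)^2\le A_k\le C_D\,\rho_k(S)^2 . \] If moreover $S$ is Ahlfors regular of dimension $r>0$, then $A_k\asymp k^{-2/r}$ as $k\to\infty$.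
   Context: Setting. For contexts $q\in\mathcal Q$ and actions $a\in\mathcal A$, the one-observation experiments $\mathcal E_{q,a}$ (parameter $\theta\in\Theta\subseteq\mathbb R$) are differentiable in quadratic mean at a fixed interior point $\theta_0$ with Fisher information $I(q,a)$. At every context, every finite set of actions, and also the full action space, has an (attained, measurable) greatest element in the Blackwell order ($\mathcal E\succeq_B\mathcal G$ if $\mathcal G$ is the image of $\mathcal E$ under a Markov kernel not depending on $\theta$); $I_\star(q)=\max_{a\in\mathcal A}I(q,a)>0$ for every $q$. The targets $\psi_q$ are differentiable at $\theta_0$ with derivative $b(q)=\dot\psi_q(\theta_0)$. The distortion is \[ D(q,a)=\begin{cases}0,& b(q)=0,\\ b(q)^2\{I(q,a)^{-1}-I_\star(q)^{-1}\},& b(q)\neq0,\ I(q,a)>0,\\ \infty,& b(q)\neq 0,\ I(q,a)=0,\end{cases} \] and the frontier is $A_k=\inf_{V\subset\mathcal A,\,1\le|V|\le k}\sup_{q\in\mathcal Q}\min_{a\in V}D(q,a)$. Quotient assumptions. $\mathcal Q$ is compact; $(\mathcal M,d)$ is a compact metric space and $q_{\mathcal A}:\mathcal A\to\mathcal M$ is a surjection; $D(q,a)=\overline D(q,q_{\mathcal A}(a))$ for a continuous $\overline D:\mathcal Q\times\mathcal M\to[0,\infty)$. Each context has a unique oracle class $m(q)\in\mathcal M$, meaning $\overline D(q,z)=0$ if and only if $z=m(q)$. Write $S=m(\mathcal Q)$ (then $m$ is continuous and $S$ is compact). Moreover $\mathcal M$ is a smooth Riemannian manifold near $S$, on a neighborhood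 of $S$ the metric $d$ agrees with the geodesic distance of this Riemannian structure, and $\overline D(q,z)$ is three times continuously differentiable in $z$ near the graph of $m$. Gradient and Hessian in $z$ are Riemannian. Covering radius: $\rho_k(S)=\inf_{V\subset\mathcal M,\,1\le|V|\le k}\sup_{s\in S}\min_{z\in V}d(s,z)$. $S$ is Ahlfors regular of dimension $r$ if there is a Borel measure $\mu$ on $S$ and constants $0<c\le C$ with $cR^r\le\mu\{B(s,R)\}\le CR^r$ for all $s\in S$ and all small $R>0$. $A_k\asymp k^{-2/r}$ means the ratio is bounded above and away from zero for large $k$. *)

theory Defs
  imports "HOL-Probability.Probability"
begin

section \<open>Statistical experiments\<close>

text \<open>An experiment is a family \<open>P \<theta>\<close>, \<open>\<theta> \<in> \<Theta>\<close>, of probability measures on one measurable space; the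
  values of \<open>P\<close> outside \<open>\<Theta>\<close> are irrelevant.\<close>

definition statistical_experiment :: "real set \<Rightarrow> (real \<Rightarrow> 'x measure) \<Rightarrow> bool" where
  "statistical_experiment \<Theta> P \<longleftrightarrow>
     (\<forall>\<theta>\<in>\<Theta>. prob_space (P \<theta>)) \<and> (\<forall>\<theta>\<in>\<Theta>. \<forall>\<theta>'\<in>\<Theta>. sets (P \<theta>) = sets (P \<theta>'))"

text \<open>\<open>P\<close> is differentiable in quadratic mean at \<open>\<theta>0\<close> with score \<open>l\<close>. The dominating measure \<open>\<nu>\<close> is not
  required to be sigma-finite. Square integrability of \<open>l\<close> follows from the limit; it is listed so
  that the Bochner integral in the Fisher information is visibly meaningful.\<close>

definition dqm_at :: "real set \<Rightarrow> (real \<Rightarrow> 'x measure) \<Rightarrow> real \<Rightarrow> ('x \<Rightarrow> real) \<Rightarrow> bool" where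
  "dqm_at \<Theta> P \<theta>0 l \<longleftrightarrow>
     l \<in> borel_measurable (P \<theta>0) \<and> integrable (P \<theta>0) (\<lambda>x. (l x)\<^sup>2) \<and>
     (\<exists>\<nu> p. (\<forall>\<theta>\<in>\<Theta>. p \<theta> \<in> borel_measurable \<nu> \<and> (\<forall>x\<in>space \<nu>. 0 \<le> p \<theta> x) \<and>
                    P \<theta> = density \<nu> (\<lambda>x. ennreal (p \<theta> x))) \<and>
        ((\<lambda>h. (\<integral>\<^sup>+x. ennreal ((sqrt (p (\<theta>0 + h) x) - sqrt (p \<theta>0 x)
                                - h / 2 * l x * sqrt (p \<theta>0 x))\<^sup>2) \<partial>\<nu>) / ennreal (h\<^sup>2))
           \<longlongrightarrow> 0) (at 0))"

definition fisher_information :: "(real \<Rightarrow> 'x measure) \<Rightarrow> real \<Rightarrow> ('x \<Rightarrow> real) \<Rightarrow> real" where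
  "fisher_information P \<theta>0 l = (LINT x|P \<theta>0. (l x)\<^sup>2)"

definition blackwell_ge ::
    "real set \<Rightarrow> (real \<Rightarrow> 'x measure) \<Rightarrow> (real \<Rightarrow> 'y measure) \<Rightarrow> bool" where
  "blackwell_ge \<Theta> P R \<longleftrightarrow>
     (\<exists>K. \<forall>\<theta>\<in>\<Theta>. K \<in> measurable (P \<theta>) (prob_algebra (R \<theta>)) \<and> R \<theta> = P \<theta> \<bind> K)"

section \<open>Distortion, frontier, covering radius\<close>

definition distortion ::
    "('q \<Rightarrow> real) \<Rightarrow> ('q \<Rightarrow> 'a \<Rightarrow> real) \<Rightarrow> ('q \<Rightarrow> real) \<Rightarrow> 'q \<Rightarrow> 'a \<Rightarrow> ereal" where
  "distortion b I Istar q a =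
     (if b q = 0 then 0
      else if I q a > 0 then ereal ((b q)\<^sup>2 * (inverse (I q a) - inverse (Istar q)))
      else \<infinity>)"

text \<open>The condition \<open>1 \<le> card V\<close> forces \<open>V\<close> to be finite and nonempty, so that \<open>MIN\<close> is meaningful.\<close>

definition frontier_value :: "('q \<Rightarrow> 'a \<Rightarrow> ereal) \<Rightarrow> nat \<Rightarrow> ereal" where
  "frontier_value D k =
     (INF V\<in>{V. 1 \<le> card V \<and> card V \<le> k}. SUP q. MIN a\<in>V. D q a)"

definition covering_radius :: "'m::metric_space set \<Rightarrow> nat \<Rightarrow> ereal" where
  "covering_radius S k =
     (INF V\<in>{V. 1 \<le> card V \<and> card V \<le> k}. SUP s\<in>S. MIN z\<in>V. ereal (dist s z))"

definition ahlfors_regular :: "'m::metric_space set \<Rightarrow> real \<Rightarrow> bool" where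
  "ahlfors_regular S r \<longleftrightarrow>
     (\<exists>\<mu> c C. sets \<mu> = sets (restrict_space borel S) \<and> 0 < c \<and> c \<le> C \<and>
        (\<exists>R0>0. \<forall>s\<in>S. \<forall>R. 0 < R \<and> R < R0 \<longrightarrow>
           ennreal (c * R powr r) \<le> emeasure \<mu> (S \<inter> ball s R) \<and>
           emeasure \<mu> (S \<inter> ball s R) \<le> ennreal (C * R powr r)))"

section \<open>Differentiability classes\<close>

text \<open>On an open subset of a Euclidean space, continuity of all iterated directional derivatives of a
  function that is differentiable at every stage is the usual class \<open>C\<^sup>k\<close>.\<close>

fun Ck_on :: "nat \<Rightarrow> ('e::euclidean_space \<Rightarrow> 'f::real_normed_vector) \<Rightarrow> 'e set \<Rightarrow> bool" where
  "Ck_on 0 f S \<longleftrightarrow> continuous_on S f"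
| "Ck_on (Suc k) f S \<longleftrightarrow>
     (\<forall>x\<in>S. f differentiable (at x)) \<and> (\<forall>v. Ck_on k (\<lambda>x. frechet_derivative f (at x) v) S)"

definition smooth_on :: "('e::euclidean_space \<Rightarrow> 'f::real_normed_vector) \<Rightarrow> 'e set \<Rightarrow> bool" where
  "smooth_on f S \<longleftrightarrow> (\<forall>k. Ck_on k f S)"

text \<open>\<open>k\<close> times continuously differentiable in the second variable: the derivatives in that variable
  exist up to order \<open>k\<close> and are continuous in both variables jointly.\<close>

fun Ck_in_snd :: "nat \<Rightarrow> ('q::topological_space \<Rightarrow> 'e::euclidean_space \<Rightarrow> 'f::real_normed_vector)
    \<Rightarrow> ('q \<times> 'e) set \<Rightarrow> bool" where
  "Ck_in_snd 0 F W \<longleftrightarrow> continuous_on W (\<lambda>(q, x). F q x)"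
| "Ck_in_snd (Suc k) F W \<longleftrightarrow>
     continuous_on W (\<lambda>(q, x). F q x) \<and>
     (\<forall>(q, x)\<in>W. F q differentiable (at x)) \<and>
     (\<forall>v. Ck_in_snd k (\<lambda>q x. frechet_derivative (F q) (at x) v) W)"

section \<open>Riemannian structures on an open part of a metric space\<close>

type_synonym ('m, 'e) chart = "'m set \<times> ('m \<Rightarrow> 'e)"

definition chart_image :: "('m, 'e) chart \<Rightarrow> 'e set" where
  "chart_image c = snd c ` fst c"

definition chart_inv :: "('m, 'e) chart \<Rightarrow> 'e \<Rightarrow> 'm" where
  "chart_inv c = inv_into (fst c) (snd c)"

text \<open>A smooth atlas of the open set \<open>\<Union> (fst ` A)\<close>. Hausdorffness and second countability are
  automatic when the ambient metric space is compact.\<close>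

definition smooth_atlas :: "('m::metric_space, 'e::euclidean_space) chart set \<Rightarrow> bool" where
  "smooth_atlas A \<longleftrightarrow>
     (\<forall>c\<in>A. open (fst c) \<and> open (chart_image c) \<and>
             homeomorphism (fst c) (chart_image c) (snd c) (chart_inv c)) \<and>
     (\<forall>c\<in>A. \<forall>c'\<in>A. smooth_on (snd c' \<circ> chart_inv c) (snd c ` (fst c \<inter> fst c')))"

text \<open>A Riemannian metric is given by its coordinate expressions: \<open>g c x v w\<close> is the inner product, at
  the point with coordinates \<open>x\<close> in the chart \<open>c\<close>, of the tangent vectors with components \<open>v\<close> and \<open>w\<close>.
  The last clause is the transformation rule of a covariant tensor of degree two.\<close>

definition riemannian_metric ::
    "('m::metric_space, 'e::euclidean_space) chart set
       \<Rightarrow> (('m, 'e) chart \<Rightarrow> 'e \<Rightarrow> 'e \<Rightarrow> 'e \<Rightarrow> real) \<Rightarrow> bool" where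
  "riemannian_metric A g \<longleftrightarrow>
     (\<forall>c\<in>A. (\<forall>v w. smooth_on (\<lambda>x. g c x v w) (chart_image c)) \<and>
        (\<forall>x\<in>chart_image c. bilinear (g c x) \<and> (\<forall>v w. g c x v w = g c x w v) \<and>
           (\<forall>v. v \<noteq> 0 \<longrightarrow> g c x v v > 0))) \<and>
     (\<forall>c\<in>A. \<forall>c'\<in>A. \<forall>x\<in>snd c ` (fst c \<inter> fst c'). \<forall>v w.
        (let T = snd c' \<circ> chart_inv c; T' = frechet_derivative T (at x)
         in g c x v w = g c' (T x) (T' v) (T' w)))"

definition pw_C1_curve ::
    "('m::metric_space, 'e::euclidean_space) chart set \<Rightarrow> (real \<Rightarrow> 'm) \<Rightarrow> bool" where
  "pw_C1_curve A \<gamma> \<longleftrightarrow>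
     path \<gamma> \<and> path_image \<gamma> \<subseteq> \<Union> (fst ` A) \<and>
     (\<exists>F. finite F \<and>
        (\<forall>c\<in>A. (snd c \<circ> \<gamma>) C1_differentiable_on ({t\<in>{0<..<1}. \<gamma> t \<in> fst c} - F)))"

text \<open>The speed does not depend on the selected chart, by the transformation rule for \<open>g\<close>.\<close>

definition curve_speed ::
    "('m::metric_space, 'e::euclidean_space) chart set
       \<Rightarrow> (('m, 'e) chart \<Rightarrow> 'e \<Rightarrow> 'e \<Rightarrow> 'e \<Rightarrow> real) \<Rightarrow> (real \<Rightarrow> 'm) \<Rightarrow> real \<Rightarrow> real" where
  "curve_speed A g \<gamma> t =
     (let c = (SOME c. c \<in> A \<and> \<gamma> t \<in> fst c);
          v = vector_derivative (snd c \<circ> \<gamma>) (at t)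
      in sqrt (g c (snd c (\<gamma> t)) v v))"

definition curve_length ::
    "('m::metric_space, 'e::euclidean_space) chart set
       \<Rightarrow> (('m, 'e) chart \<Rightarrow> 'e \<Rightarrow> 'e \<Rightarrow> 'e \<Rightarrow> real) \<Rightarrow> (real \<Rightarrow> 'm) \<Rightarrow> ennreal" where
  "curve_length A g \<gamma> = (\<integral>\<^sup>+t\<in>{0..1}. ennreal (curve_speed A g \<gamma> t) \<partial>lborel)"

text \<open>This is \<open>\<infinity>\<close> for points in different components of \<open>\<Union> (fst ` A)\<close>.\<close>

definition geodesic_dist ::
    "('m::metric_space, 'e::euclidean_space) chart set
       \<Rightarrow> (('m, 'e) chart \<Rightarrow> 'e \<Rightarrow> 'e \<Rightarrow> 'e \<Rightarrow> real) \<Rightarrow> 'm \<Rightarrow> 'm \<Rightarrow> ennreal" where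
  "geodesic_dist A g x y =
     (INF \<gamma>\<in>{\<gamma>. pw_C1_curve A \<gamma> \<and> pathstart \<gamma> = x \<and> pathfinish \<gamma> = y}. curve_length A g \<gamma>)"

text \<open>Agreement is required only between points that are close to each other, since \<open>S\<close> may meet several
  components of the manifold, between which the geodesic distance is infinite.\<close>

definition dist_geodesic_near ::
    "('m::metric_space, 'e::euclidean_space) chart set
       \<Rightarrow> (('m, 'e) chart \<Rightarrow> 'e \<Rightarrow> 'e \<Rightarrow> 'e \<Rightarrow> real) \<Rightarrow> 'm set \<Rightarrow> bool" where
  "dist_geodesic_near A g S \<longleftrightarrow>
     (\<forall>s\<in>S. \<exists>W. open W \<and> s \<in> W \<and>
        (\<forall>x\<in>W. \<forall>y\<in>W. geodesic_dist A g x y = ennreal (dist x y)))"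

text \<open>Christoffel symbols, gradient and Hessian for a metric \<open>G\<close> on an open subset of \<open>'e\<close>.
  \<open>christoffel G x v w\<close> is the vector with components \<open>\<Gamma>\<^sup>i\<^sub>j\<^sub>k v\<^sup>j w\<^sup>k\<close>, and \<open>coord_hessian G f x\<close> is the
  covariant Hessian \<open>\<partial>\<^sub>j\<partial>\<^sub>k f - \<Gamma>\<^sup>i\<^sub>j\<^sub>k \<partial>\<^sub>i f\<close> as a bilinear form.\<close>

definition christoffel ::
    "('e::euclidean_space \<Rightarrow> 'e \<Rightarrow> 'e \<Rightarrow> real) \<Rightarrow> 'e \<Rightarrow> 'e \<Rightarrow> 'e \<Rightarrow> 'e" where
  "christoffel G x v w =
     (THE u. \<forall>y. G x u y =
        (frechet_derivative (\<lambda>x. G x w y) (at x) v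
         + frechet_derivative (\<lambda>x. G x v y) (at x) w
         - frechet_derivative (\<lambda>x. G x v w) (at x) y) / 2)"

definition coord_gradient ::
    "('e::euclidean_space \<Rightarrow> 'e \<Rightarrow> 'e \<Rightarrow> real) \<Rightarrow> ('e \<Rightarrow> real) \<Rightarrow> 'e \<Rightarrow> 'e" where
  "coord_gradient G f x = (THE u. \<forall>v. G x u v = frechet_derivative f (at x) v)"

definition coord_hessian ::
    "('e::euclidean_space \<Rightarrow> 'e \<Rightarrow> 'e \<Rightarrow> real) \<Rightarrow> ('e \<Rightarrow> real) \<Rightarrow> 'e \<Rightarrow> 'e \<Rightarrow> 'e \<Rightarrow> real" where
  "coord_hessian G f x v w =
     frechet_derivative (\<lambda>y. frechet_derivative f (at y) w) (at x) v
     - frechet_derivative f (at x) (christoffel G x v w)"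

text \<open>Riemannian gradient and Hessian at the point \<open>p\<close>, in the components of the chart \<open>c\<close>.\<close>

definition riem_gradient ::
    "(('m, 'e::euclidean_space) chart \<Rightarrow> 'e \<Rightarrow> 'e \<Rightarrow> 'e \<Rightarrow> real) \<Rightarrow> ('m, 'e) chart
       \<Rightarrow> ('m \<Rightarrow> real) \<Rightarrow> 'm \<Rightarrow> 'e" where
  "riem_gradient g c f p = coord_gradient (g c) (f \<circ> chart_inv c) (snd c p)"

definition riem_hessian ::
    "(('m, 'e::euclidean_space) chart \<Rightarrow> 'e \<Rightarrow> 'e \<Rightarrow> 'e \<Rightarrow> real) \<Rightarrow> ('m, 'e) chart
       \<Rightarrow> ('m \<Rightarrow> real) \<Rightarrow> 'm \<Rightarrow> 'e \<Rightarrow> 'e \<Rightarrow> real" where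
  "riem_hessian g c f p = coord_hessian (g c) (f \<circ> chart_inv c) (snd c p)"

text \<open>Eigenvalues of a form \<open>H\<close> relative to the inner product \<open>G\<close>, i.e. of the endomorphism \<open>T\<close>
  with \<open>G (T v) w = H v w\<close>.\<close>

definition form_eigenvalue ::
    "('e::euclidean_space \<Rightarrow> 'e \<Rightarrow> real) \<Rightarrow> ('e \<Rightarrow> 'e \<Rightarrow> real) \<Rightarrow> real \<Rightarrow> bool" where
  "form_eigenvalue G H lam \<longleftrightarrow> (\<exists>v. v \<noteq> 0 \<and> (\<forall>w. H v w = lam * G v w))"

text \<open>\<open>D q z\<close> is three times continuously differentiable in \<open>z\<close> near the graph of \<open>m\<close>.\<close>

definition C3_near_graph ::
    "('m::metric_space, 'e::euclidean_space) chart set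
       \<Rightarrow> ('q::topological_space \<Rightarrow> 'm \<Rightarrow> real) \<Rightarrow> ('q \<Rightarrow> 'm) \<Rightarrow> bool" where
  "C3_near_graph A D m \<longleftrightarrow>
     (\<exists>W. open W \<and> (\<forall>q. (q, m q) \<in> W) \<and>
        (\<forall>c\<in>A. Ck_in_snd 3 (\<lambda>q x. D q (chart_inv c x))
                  {(q, x). x \<in> chart_image c \<and> (q, chart_inv c x) \<in> W}))"

definition separation :: "('q \<Rightarrow> 'm::metric_space \<Rightarrow> real) \<Rightarrow> ('q \<Rightarrow> 'm) \<Rightarrow> real \<Rightarrow> ereal" where
  "separation D m \<epsilon> = (INF (q, z)\<in>{(q, z). dist z (m q) \<ge> \<epsilon>}. ereal (D q z))"

end

theory Submission
  imports Defs
begin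

text \<open>
  The distortion and the squared distance to the oracle class are comparable on all of
  the product of contexts and classes: once \<open>D q z \<le> C d(z, m q)\<^sup>2\<close> and \<open>d(z, m q)\<^sup>2 \<le> C D q z\<close> hold everywhere, an
  admissible set of size \<open>k\<close> for one problem is admissible for the other, with the value changed by a
  bounded factor. By compactness the comparison is local. Off the graph of \<open>m\<close> both sides are
  continuous and positive. At a point of the graph, work in one chart: \<open>m q\<close> minimizes \<open>D q\<close>, so the
  differential vanishes there, the Riemannian Hessian is the coordinate Hessian, and Taylor's formula
  gives two-sided quadratic bounds in coordinates, with constants uniform in \<open>q\<close> by continuity of the
  second derivatives; the geodesic distance is comparable to the coordinate distance.

  For Ahlfors regular \<open>S\<close>, counting mass in the balls of a cover bounds the covering radius from
  below, and in the disjoint balls around a maximal separated set from above.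
\<close>

section \<open>Covering numbers\<close>

lemma minimax_le:
  fixes f :: "'x \<Rightarrow> 'v \<Rightarrow> real"
  assumes V: "1 \<le> card V" "card V \<le> k" and le: "\<And>x. x \<in> X \<Longrightarrow> \<exists>z\<in>V. f x z \<le> t"
  shows "(INF V\<in>{V. 1 \<le> card V \<and> card V \<le> k}. SUP x\<in>X. MIN z\<in>V. ereal (f x z)) \<le> ereal t"
proof (rule INF_lower2)
  show "V \<in> {V. 1 \<le> card V \<and> card V \<le> k}" using V by simp
  have fin: "finite V" using V by (simp add: card_ge_0_finite)
  show "(SUP x\<in>X. MIN z\<in>V. ereal (f x z)) \<le> ereal t"
  proof (rule SUP_least)
    fix x assume "x \<in> X"
    then obtain z where z: "z \<in> V" "f x z \<le> t" using le by blast
    have "(MIN z\<in>V. ereal (f x z)) \<le> ereal (f x z)" using fin z by (intro Min_le) auto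
    also have "\<dots> \<le> ereal t" using z by simp
    finally show "(MIN z\<in>V. ereal (f x z)) \<le> ereal t" .
  qed
qed

text \<open>The infimum over \<open>V\<close> need not be attained, so a good finite set is
  extracted only at thresholds strictly above the value.\<close>

lemma minimax_less:
  fixes f :: "'x \<Rightarrow> 'v \<Rightarrow> real"
  assumes "(INF V\<in>{V. 1 \<le> card V \<and> card V \<le> k}. SUP x\<in>X. MIN z\<in>V. ereal (f x z)) < ereal t"
  obtains V where "1 \<le> card V" "card V \<le> k" "finite V" "\<And>x. x \<in> X \<Longrightarrow> \<exists>z\<in>V. f x z \<le> t"
proof -
  obtain V where V: "1 \<le> card V" "card V \<le> k"
    and less: "(SUP x\<in>X. MIN z\<in>V. ereal (f x z)) < ereal t"
    using assms by (auto simp: INF_less_iff)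
  have fin: "finite V" "V \<noteq> {}" using V by (auto simp: card_ge_0_finite)
  have "\<exists>z\<in>V. f x z \<le> t" if "x \<in> X" for x
  proof -
    have "(MIN z\<in>V. ereal (f x z)) < ereal t"
      using less SUP_upper[OF that, of "\<lambda>x. MIN z\<in>V. ereal (f x z)"] by (rule le_less_trans[rotated])
    then show ?thesis using fin by (subst (asm) Min_less_iff) (auto intro: less_imp_le)
  qed
  with that V fin show thesis by blast
qed

text \<open>Bounds on \<open>f\<close> make the value finite, so that later estimates take place in
  the reals. A point of \<open>X\<close> keeps the supremum nonnegative, and
  \<open>1 \<le> k\<close> admits singletons.\<close>

lemma minimax_real:
  fixes f :: "'x \<Rightarrow> 'v \<Rightarrow> real"
  assumes "X \<noteq> {}" "1 \<le> k" and nonneg: "\<And>x z. 0 \<le> f x z" and bd: "\<And>x z. f x z \<le> B"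
  obtains u where "0 \<le> u"
    "(INF V\<in>{V. 1 \<le> card V \<and> card V \<le> k}. SUP x\<in>X. MIN z\<in>V. ereal (f x z)) = ereal u"
proof -
  let ?u = "INF V\<in>{V. 1 \<le> card V \<and> card V \<le> k}. SUP x\<in>X. MIN z\<in>V. ereal (f x z)"
  have "?u \<le> ereal B" using assms by (intro minimax_le[of "{undefined}"]) auto
  moreover have "0 \<le> ?u"
  proof (rule INF_greatest)
    fix V :: "'v set" assume "V \<in> {V. 1 \<le> card V \<and> card V \<le> k}"
    then have fin: "finite V" "V \<noteq> {}" by (auto simp: card_ge_0_finite)
    obtain x where "x \<in> X" using assms by blast
    have "0 \<le> (MIN z\<in>V. ereal (f x z))" using fin nonneg by (subst Min_ge_iff) auto
    also have "\<dots> \<le> (SUP x\<in>X. MIN z\<in>V. ereal (f x z))" by (rule SUP_upper) fact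
    finally show "0 \<le> (SUP x\<in>X. MIN z\<in>V. ereal (f x z))" .
  qed
  ultimately obtain u where "?u = ereal u" "0 \<le> u" by (cases ?u) auto
  with that show thesis by blast
qed

text \<open>Finite sets transfer both ways without growing: classes lift to actions through a right
  inverse of \<open>qA\<close>, and actions descend through \<open>qA\<close>. Optimal sets may fail
  to exist, so each inequality is proved by contradiction, with a threshold \<open>t\<close>
  strictly above the value in question.\<close>

lemma frontier_value_comparable:
  fixes Dbar :: "'q \<Rightarrow> 'm::metric_space \<Rightarrow> real" and qA :: "'a \<Rightarrow> 'm"
  assumes C: "0 < C" and k: "1 \<le> k" and M_compact: "compact (UNIV :: 'm set)" and surj: "surj qA"
    and D: "\<And>q a. D q a = ereal (Dbar q (qA a))"
    and nonneg: "\<And>q z. 0 \<le> Dbar q z"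
    and upper: "\<And>q z. Dbar q z \<le> C * (dist z (m q))\<^sup>2"
    and lower: "\<And>q z. (dist z (m q))\<^sup>2 \<le> C * Dbar q z"
  obtains u v where "0 \<le> u" "0 \<le> v" "frontier_value D k = ereal u"
    "covering_radius (range m) k = ereal v" "u \<le> C * v\<^sup>2" "v\<^sup>2 \<le> C * u"
proof -
  have bd: "dist x y \<le> diameter (UNIV :: 'm set)" for x y :: 'm
    using diameter_bounded_bound[OF compact_imp_bounded[OF M_compact]] by simp
  have bd2: "Dbar q z \<le> C * (diameter (UNIV :: 'm set))\<^sup>2" for q z
    using upper[of q z] mult_left_mono[OF power_mono[OF bd zero_le_dist], of C] C
    by (meson less_imp_le order_trans)
  have F: "frontier_value D k = (INF V\<in>{V. 1 \<le> card V \<and> card V \<le> k}.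
      SUP q\<in>UNIV. MIN a\<in>V. ereal (Dbar q (qA a)))"
    by (simp add: frontier_value_def D)
  obtain u where u: "0 \<le> u" "frontier_value D k = ereal u"
    using minimax_real[of UNIV k "\<lambda>q a. Dbar q (qA a)", OF _ k nonneg bd2] unfolding F by blast
  obtain v where v: "0 \<le> v" "covering_radius (range m) k = ereal v"
    using minimax_real[of "range m" k dist, OF _ k zero_le_dist bd] unfolding covering_radius_def by blast
  have "u \<le> C * v\<^sup>2"
  proof (rule ccontr)
    assume "\<not> u \<le> C * v\<^sup>2"
    then have "v\<^sup>2 < u / C" using C by (simp add: field_simps)
    then have "v < sqrt (u / C)" using real_less_rsqrt by blast
    then obtain t where t: "v < t" "t < sqrt (u / C)" using dense by blast
    then have "covering_radius (range m) k < ereal t" using v by simp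
    then obtain V where V: "1 \<le> card V" "card V \<le> k" "finite V"
      "\<And>s. s \<in> range m \<Longrightarrow> \<exists>z\<in>V. dist s z \<le> t"
      unfolding covering_radius_def by (rule minimax_less) blast
    \<comment> \<open>One action is chosen in each class of \<open>V\<close>; a right inverse is
      injective, so the cardinality is preserved.\<close>
    have "ereal u \<le> ereal (C * t\<^sup>2)" unfolding u(2)[symmetric] F
    proof (rule minimax_le[of "inv qA ` V"])
      have "card (inv qA ` V) = card V"
        by (rule card_image) (metis inj_on_subset subset_UNIV surj surj_imp_inj_inv)
      then show "1 \<le> card (inv qA ` V)" "card (inv qA ` V) \<le> k" using V by auto
      fix q
      obtain z where z: "z \<in> V" "dist (m q) z \<le> t" using V(4) by blast
      have "Dbar q z \<le> C * (dist z (m q))\<^sup>2" by (rule upper)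
      also have "\<dots> \<le> C * t\<^sup>2" using z C by (intro mult_left_mono power_mono) (auto simp: dist_commute)
      finally show "\<exists>a\<in>inv qA ` V. Dbar q (qA a) \<le> C * t\<^sup>2"
        using z surj by (auto simp: surj_f_inv_f)
    qed
    moreover have "t\<^sup>2 < u / C"
      using t v power_strict_mono[of t "sqrt (u / C)" 2] u C by simp
    ultimately show False using C by (simp add: field_simps)
  qed
  moreover have "v\<^sup>2 \<le> C * u"
  proof (rule ccontr)
    assume "\<not> v\<^sup>2 \<le> C * u"
    then have "u < v\<^sup>2 / C" using C by (simp add: field_simps)
    then obtain t where t: "u < t" "t < v\<^sup>2 / C" using dense by blast
    then have "frontier_value D k < ereal t" using u by simp
    then obtain V where V: "1 \<le> card V" "card V \<le> k" "finite V"
      "\<And>q. q \<in> UNIV \<Longrightarrow> \<exists>a\<in>V. Dbar q (qA a) \<le> t"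
      unfolding F by (rule minimax_less) blast
    \<comment> \<open>An action of distortion at most \<open>t\<close> has its class within
      \<open>sqrt (C * t)\<close> of the oracle class. Since \<open>C * t < v\<^sup>2\<close>, this
      beats the covering radius \<open>v\<close>.\<close>
    have "ereal v \<le> ereal (sqrt (C * t))" unfolding v(2)[symmetric] covering_radius_def
    proof (rule minimax_le[of "qA ` V"])
      have "V \<noteq> {}" using V by auto
      then show "1 \<le> card (qA ` V)" using V(3) by (simp add: Suc_le_eq card_gt_0_iff)
      show "card (qA ` V) \<le> k" using card_image_le[OF V(3), of qA] V(2) by simp
      fix s assume "s \<in> range m"
      then obtain q where q: "s = m q" by blast
      obtain a where a: "a \<in> V" "Dbar q (qA a) \<le> t" using V(4) by blast
      have "(dist (qA a) (m q))\<^sup>2 \<le> C * Dbar q (qA a)" by (rule lower)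
      also have "\<dots> \<le> C * t" using a C by simp
      finally have "dist (qA a) (m q) \<le> sqrt (C * t)" by (rule real_le_rsqrt)
      then show "\<exists>z\<in>qA ` V. dist s z \<le> sqrt (C * t)" using a q by (auto simp: dist_commute)
    qed
    then have "v\<^sup>2 \<le> (sqrt (C * t))\<^sup>2" using v(1) by (intro power_mono) auto
    also have "\<dots> = C * t" using C t u by (simp add: mult_nonneg_nonneg)
    finally show False using t C by (simp add: field_simps)
  qed
  ultimately show thesis using that u v by blast
qed

section \<open>Mass counting for Ahlfors regular sets\<close>

text \<open>Regularity concerns balls centred in \<open>S\<close>, whereas the centres of a cover
  are arbitrary. If the ball around \<open>z\<close> meets \<open>S\<close> in \<open>s\<close>, its
  points are within \<open>2 * t\<close> of \<open>s\<close>; the radius \<open>4 * t\<close> leaves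
  room to spare.\<close>

lemma emeasure_cball_le:
  fixes \<mu> :: "'m::metric_space measure"
  assumes sets: "sets \<mu> = sets (restrict_space borel S)" and t: "0 < t" "4 * t < R0"
    and upper: "\<And>s R. s \<in> S \<Longrightarrow> 0 < R \<Longrightarrow> R < R0 \<Longrightarrow> emeasure \<mu> (S \<inter> ball s R) \<le> ennreal (C * R powr r)"
  shows "emeasure \<mu> (S \<inter> cball z t) \<le> ennreal (C * (4 * t) powr r)"
proof (cases "S \<inter> cball z t = {}")
  case False
  then obtain s where s: "s \<in> S" "dist z s \<le> t" by auto
  have "S \<inter> cball z t \<subseteq> S \<inter> ball s (4 * t)"
  proof
    fix y assume "y \<in> S \<inter> cball z t"
    then have "dist s y \<le> 2 * t" using s dist_triangle[of s y z] by (auto simp: dist_commute)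
    then show "y \<in> S \<inter> ball s (4 * t)" using t \<open>y \<in> _\<close> by auto
  qed
  moreover have "S \<inter> ball s (4 * t) \<in> sets \<mu>" unfolding sets by (auto simp: sets_restrict_space)
  ultimately have "emeasure \<mu> (S \<inter> cball z t) \<le> emeasure \<mu> (S \<inter> ball s (4 * t))"
    by (rule emeasure_mono)
  also have "\<dots> \<le> ennreal (C * (4 * t) powr r)" using s t by (intro upper) auto
  finally show ?thesis .
qed simp

lemma powr_neg_inverse_powr:
  assumes "0 < r" shows "(real k powr (- 1 / r)) powr r = 1 / real k"
proof -
  have "(real k powr (- 1 / r)) powr r = real k powr (- 1)" using assms by (simp only: powr_powr) simp
  also have "\<dots> = 1 / real k" using powr_minus_divide[of "real k" 1] by simp
  finally show ?thesis .
qed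

text \<open>When \<open>k\<close> balls of radius \<open>t\<close> cover \<open>S\<close>, their
  masses add up to at least the mass of \<open>S\<close>. For \<open>t\<close> proportional to
  \<open>k powr (- 1 / r)\<close> the factor \<open>k\<close> cancels, and a small enough
  \<open>\<kappa>\<close> makes the sum fall short.\<close>

lemma Ahlfors_covering_lower:
  fixes \<mu> :: "'m::metric_space measure"
  assumes sets: "sets \<mu> = sets (restrict_space borel S)" and "S \<noteq> {}" and r: "0 < r" and c: "0 < c" "c \<le> C" and "0 < R0"
    and lower: "\<And>s R. s \<in> S \<Longrightarrow> 0 < R \<Longrightarrow> R < R0 \<Longrightarrow> ennreal (c * R powr r) \<le> emeasure \<mu> (S \<inter> ball s R)"
    and upper: "\<And>s R. s \<in> S \<Longrightarrow> 0 < R \<Longrightarrow> R < R0 \<Longrightarrow> emeasure \<mu> (S \<inter> ball s R) \<le> ennreal (C * R powr r)"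
  obtains \<kappa> where "0 < \<kappa>" "\<And>k. 1 \<le> k \<Longrightarrow> ereal (\<kappa> * real k powr (- 1 / r)) \<le> covering_radius S k"
proof -
  obtain s0 where s0: "s0 \<in> S" using assms by blast
  \<comment> \<open>A positive lower bound for the mass of \<open>S\<close>, read off from one ball
    of the admissible radius \<open>R0 / 2\<close>.\<close>
  define M0 where "M0 = c * (R0 / 2) powr r"
  have M0: "0 < M0" using c \<open>0 < R0\<close> by (simp add: M0_def)
  have space: "space \<mu> = S" using sets_eq_imp_space_eq[OF sets] by (simp add: space_restrict_space)
  have M0_le: "ennreal M0 \<le> emeasure \<mu> S"
  proof -
    have "ennreal M0 \<le> emeasure \<mu> (S \<inter> ball s0 (R0 / 2))"
      unfolding M0_def using lower[of s0 "R0/2"] s0 \<open>0 < R0\<close> by simp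
    also have "\<dots> \<le> emeasure \<mu> S" using space by (intro emeasure_mono) auto
    finally show ?thesis .
  qed
  \<comment> \<open>The first term keeps \<open>4 * t\<close> below \<open>R0\<close>; the second
    limits the total mass of the \<open>k\<close> balls to \<open>M0 / 2\<close>.\<close>
  define \<kappa> where "\<kappa> = min (R0 / 8) ((M0 / (2 * C)) powr (1 / r) / 4)"
  have \<kappa>: "0 < \<kappa>" "\<kappa> \<le> R0 / 8" "4 * \<kappa> \<le> (M0 / (2 * C)) powr (1 / r)"
    using \<open>0 < R0\<close> M0 c by (auto simp: \<kappa>_def)
  have key: "C * (4 * \<kappa>) powr r < M0"
  proof -
    have "(4 * \<kappa>) powr r \<le> ((M0 / (2 * C)) powr (1 / r)) powr r" using \<kappa> r by (intro powr_mono2) auto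
    also have "\<dots> = M0 / (2 * C)" using r M0 c by (simp add: powr_powr)
    finally show ?thesis using M0 c by (simp add: field_simps)
  qed
  show thesis
  proof (rule that)
    show "0 < \<kappa>" by (rule \<kappa>)
    fix k :: nat assume k: "1 \<le> k"
    define t where "t = \<kappa> * real k powr (- 1 / r)"
    have "real k powr (- 1 / r) \<le> real k powr 0" using k r by (intro powr_mono) auto
    then have t: "0 < t" "t \<le> \<kappa>" using k \<kappa> by (auto simp: t_def)
    have tr: "(4 * t) powr r = (4 * \<kappa>) powr r / real k"
    proof -
      have "(4 * t) powr r = (4 * \<kappa>) powr r * (real k powr (- 1 / r)) powr r"
        using \<kappa> by (simp add: t_def powr_mult mult.assoc[symmetric])
      also have "(real k powr (- 1 / r)) powr r = 1 / real k" using r by (rule powr_neg_inverse_powr)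
      finally show ?thesis by simp
    qed
    show "ereal (\<kappa> * real k powr (- 1 / r)) \<le> covering_radius S k"
    proof (rule ccontr)
      assume "\<not> ereal (\<kappa> * real k powr (- 1 / r)) \<le> covering_radius S k"
      then have "covering_radius S k < ereal t" by (simp add: t_def)
      then obtain V where V: "1 \<le> card V" "card V \<le> k" "finite V"
        "\<And>s. s \<in> S \<Longrightarrow> \<exists>z\<in>V. dist s z \<le> t"
        unfolding covering_radius_def by (rule minimax_less) blast
      have *: "S \<inter> cball z t \<in> sets \<mu>" for z unfolding sets by (auto simp: sets_restrict_space)
      have ball: "emeasure \<mu> (S \<inter> cball z t) \<le> ennreal (C * (4 * t) powr r)" for z
        using t \<kappa> \<open>0 < R0\<close> by (intro emeasure_cball_le[OF sets, of t R0] upper) auto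
      have "ennreal M0 \<le> emeasure \<mu> S" by (rule M0_le)
      also have "\<dots> \<le> emeasure \<mu> (\<Union>z\<in>V. S \<inter> cball z t)"
        using V(3,4) * by (intro emeasure_mono sets.finite_UN) (auto simp: dist_commute)
      also have "\<dots> \<le> (\<Sum>z\<in>V. emeasure \<mu> (S \<inter> cball z t))"
        using V(3) * by (intro emeasure_subadditive_finite) auto
      also have "\<dots> \<le> (\<Sum>z\<in>V. ennreal (C * (4 * t) powr r))" by (intro sum_mono ball)
      also have "\<dots> = ennreal (real (card V) * (C * (4 * t) powr r))"
        using c by (simp add: ennreal_mult ennreal_of_nat_eq_real_of_nat)
      also have "\<dots> \<le> ennreal (real k * (C * (4 * t) powr r))"
        using V c by (intro ennreal_leI mult_right_mono) auto
      also have "real k * (C * (4 * t) powr r) = C * (4 * \<kappa>) powr r" using k by (simp add: tr)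
      finally have "M0 \<le> C * (4 * \<kappa>) powr r" using M0 c by (subst (asm) ennreal_le_iff) auto
      with key show False by simp
    qed
  qed
qed

text \<open>A \<open>t\<close>-separated subset of \<open>S\<close> of largest cardinality is a
  \<open>t\<close>-net. Its points are centres of disjoint balls of radius \<open>t / 2\<close>,
  each of mass at least \<open>c * (t / 2) powr r\<close>, so the finite total mass bounds their
  number.\<close>

lemma Ahlfors_covering_upper:
  fixes \<mu> :: "'m::metric_space measure"
  assumes sets: "sets \<mu> = sets (restrict_space borel S)" and "S \<noteq> {}" and r: "0 < r" and c: "0 < c" "c \<le> C" and "0 < R0"
    and lower: "\<And>s R. s \<in> S \<Longrightarrow> 0 < R \<Longrightarrow> R < R0 \<Longrightarrow> ennreal (c * R powr r) \<le> emeasure \<mu> (S \<inter> ball s R)"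
    and upper: "\<And>s R. s \<in> S \<Longrightarrow> 0 < R \<Longrightarrow> R < R0 \<Longrightarrow> emeasure \<mu> (S \<inter> ball s R) \<le> ennreal (C * R powr r)"
    and M_compact: "compact (UNIV :: 'm set)"
  obtains K where "0 < K" "\<forall>\<^sub>F k in sequentially. covering_radius S k \<le> ereal (K * real k powr (- 1 / r))"
proof -
  have space: "space \<mu> = S" using sets_eq_imp_space_eq[OF sets] by (simp add: space_restrict_space)
  have ms: "S \<inter> ball s R \<in> sets \<mu>" for s R unfolding sets by (auto simp: sets_restrict_space)
  \<comment> \<open>Regularity bounds the mass of small balls only; compactness reduces the total
    mass to finitely many of them.\<close>
  have "emeasure \<mu> S < \<infinity>"
  proof -
    obtain T :: "'m set" where T: "finite T" "UNIV \<subseteq> (\<Union>x\<in>T. ball x (R0 / 8))"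
      using compactE_image[OF M_compact, of UNIV "\<lambda>x. ball x (R0 / 8)"] \<open>0 < R0\<close>
      by (metis UNIV_I UN_I centre_in_ball divide_pos_pos open_ball subsetI zero_less_numeral)
    have *: "S \<inter> cball z t \<in> sets \<mu>" for z t unfolding sets by (auto simp: sets_restrict_space)
    have "S \<subseteq> (\<Union>x\<in>T. S \<inter> cball x (R0 / 8))"
    proof
      fix s assume "s \<in> S"
      moreover obtain x where "x \<in> T" "s \<in> ball x (R0 / 8)" using T(2) by blast
      ultimately show "s \<in> (\<Union>x\<in>T. S \<inter> cball x (R0 / 8))" by (auto intro: less_imp_le)
    qed
    then have "emeasure \<mu> S \<le> emeasure \<mu> (\<Union>x\<in>T. S \<inter> cball x (R0 / 8))"
      using T(1) * by (intro emeasure_mono sets.finite_UN) auto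
    also have "\<dots> \<le> (\<Sum>x\<in>T. emeasure \<mu> (S \<inter> cball x (R0 / 8)))"
      using T(1) * by (intro emeasure_subadditive_finite) auto
    also have "\<dots> \<le> (\<Sum>x\<in>T. ennreal (C * (4 * (R0 / 8)) powr r))"
      using \<open>0 < R0\<close> by (intro sum_mono emeasure_cball_le[OF sets, of _ R0] upper) auto
    also have "\<dots> < \<infinity>" using T(1) by (simp add: ennreal_mult_less_top of_nat_less_top)
    finally show ?thesis .
  qed
  then obtain M1 where M1: "0 \<le> M1" "emeasure \<mu> S = ennreal M1" by (cases "emeasure \<mu> S") auto
  \<comment> \<open>With \<open>t = K * real k powr (- 1 / r)\<close>, each ball of radius
    \<open>t / 2\<close> has mass at least \<open>(M1 + 1) / k\<close>, so at most \<open>k\<close>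
    disjoint ones fit into mass \<open>M1\<close>. The summand 1 makes \<open>K\<close> positive at
    once.\<close>
  define K where "K = 2 * ((M1 + 1) / c) powr (1 / r)"
  have K: "0 < K" using M1 c by (simp add: K_def)
  have Kr: "c * (K / 2) powr r = M1 + 1" using M1 c r by (simp add: K_def powr_powr)
  \<comment> \<open>Regularity applies only at radii below \<open>R0\<close>, which is why the bound
    is asserted for large \<open>k\<close>.\<close>
  have "((\<lambda>k. K * real k powr (- 1 / r)) \<longlongrightarrow> K * 0) sequentially"
    using r by (intro tendsto_intros tendsto_neg_powr filterlim_real_sequentially) auto
  then have ev: "\<forall>\<^sub>F k in sequentially. K * real k powr (- 1 / r) < R0"
    using \<open>0 < R0\<close> by (intro order_tendstoD(2)[of _ "K*0"]) auto
  have "\<forall>\<^sub>F k in sequentially. covering_radius S k \<le> ereal (K * real k powr (- 1 / r))"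
    using ev eventually_ge_at_top[of 1]
  proof eventually_elim
    case (elim k)
    define t where "t = K * real k powr (- 1 / r)"
    have t: "0 < t" "t < R0" using K elim by (auto simp: t_def)
    have tr: "c * (t / 2) powr r = (M1 + 1) / real k"
    proof -
      have "(t / 2) powr r = (K / 2) powr r * (real k powr (- 1 / r)) powr r"
        using K powr_mult[of "K/2" "real k powr (- 1 / r)" r] by (simp add: t_def)
      also have "(real k powr (- 1 / r)) powr r = 1 / real k" using r by (rule powr_neg_inverse_powr)
      finally show ?thesis using Kr by (simp add: field_simps)
    qed
    define sep where "sep P \<longleftrightarrow> finite P \<and> P \<subseteq> S \<and> (\<forall>x\<in>P. \<forall>y\<in>P. x \<noteq> y \<longrightarrow> t < dist x y)" for P
    have card: "card P \<le> k" if "sep P" for P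
    proof -
      have P: "finite P" "P \<subseteq> S" "\<And>x y. x \<in> P \<Longrightarrow> y \<in> P \<Longrightarrow> x \<noteq> y \<Longrightarrow> t < dist x y"
        using that by (auto simp: sep_def)
      have dj: "disjoint_family_on (\<lambda>x. S \<inter> ball x (t / 2)) P"
        unfolding disjoint_family_on_def
      proof (intro ballI impI equals0I)
        fix x y z assume "x \<in> P" "y \<in> P" "x \<noteq> y" "z \<in> S \<inter> ball x (t / 2) \<inter> (S \<inter> ball y (t / 2))"
        then show False using P(3)[of x y] dist_triangle[of x y z] by (auto simp: dist_commute)
      qed
      have "ennreal (real (card P) * ((M1 + 1) / real k)) = (\<Sum>x\<in>P. ennreal (c * (t / 2) powr r))"
        using M1 by (subst ennreal_mult) (auto simp: tr ennreal_of_nat_eq_real_of_nat)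
      also have "\<dots> \<le> (\<Sum>x\<in>P. emeasure \<mu> (S \<inter> ball x (t / 2)))"
        using P(2) t by (intro sum_mono lower) auto
      also have "\<dots> = emeasure \<mu> (\<Union>x\<in>P. S \<inter> ball x (t / 2))"
        using P(1) ms dj by (intro sum_emeasure) auto
      also have "\<dots> \<le> emeasure \<mu> S" using space by (intro emeasure_mono) auto
      finally have "real (card P) * ((M1 + 1) / real k) \<le> M1"
        using M1 by (simp add: ennreal_le_iff)
      then have "real (card P) * (M1 + 1) \<le> M1 * real k" using elim by (simp add: field_simps)
      also have "\<dots> \<le> (M1 + 1) * real k" by (simp add: algebra_simps)
      finally show ?thesis using M1 by (simp add: mult.commute)
    qed
    obtain s0 where "s0 \<in> S" using \<open>S \<noteq> {}\<close> by blast
    then have s0: "sep {s0}" by (simp add: sep_def)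
    \<comment> \<open>A largest separated set exists because \<open>k\<close> bounds all their
      cardinalities; a point of \<open>S\<close> farther than \<open>t\<close> from it could be
      added.\<close>
    obtain P where P: "sep P" "\<And>P'. sep P' \<Longrightarrow> card P' \<le> card P"
    proof -
      have "\<forall>P. sep P \<longrightarrow> card P < Suc k" using card by (simp add: less_Suc_eq_le)
      from ex_has_greatest_nat[OF s0 this] show thesis using that by blast
    qed
    have "covering_radius S k \<le> ereal t" unfolding covering_radius_def
    proof (rule minimax_le)
      show "card P \<le> k" "1 \<le> card P" using card P(1) P(2)[OF s0] by auto
      fix s assume s: "s \<in> S"
      show "\<exists>z\<in>P. dist s z \<le> t"
      proof (rule ccontr)
        assume neg: "\<not> (\<exists>z\<in>P. dist s z \<le> t)"
        then have "s \<notin> P" using t by force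
        moreover have "sep (insert s P)" using neg P(1) s by (auto simp: sep_def dist_commute not_le)
        ultimately show False using P(2)[of "insert s P"] P(1) by (simp add: sep_def)
      qed
    qed
    then show ?case by (simp add: t_def)
  qed
  with K that show thesis by blast
qed

section \<open>Quadratic growth at a nondegenerate minimum\<close>

text \<open>Expansion in the standard basis turns closeness of finitely many entries into closeness
  of the forms, uniformly in \<open>v\<close>.\<close>

lemma bilinear_diagonal_diff_le:
  fixes B B' :: "'e::euclidean_space \<Rightarrow> 'e \<Rightarrow> real"
  assumes "bilinear B" "bilinear B'"
  shows "\<bar>B v v - B' v v\<bar> \<le> (\<Sum>(i, j)\<in>Basis \<times> Basis. \<bar>B i j - B' i j\<bar>) * (norm v)\<^sup>2"
proof -
  have expand: "b v v = (\<Sum>(i, j)\<in>Basis \<times> Basis. (v \<bullet> i) * (v \<bullet> j) * b i j)"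
    if "bilinear b" for b :: "'e \<Rightarrow> 'e \<Rightarrow> real"
  proof -
    have "b v v = b (\<Sum>i\<in>Basis. (v \<bullet> i) *\<^sub>R i) (\<Sum>j\<in>Basis. (v \<bullet> j) *\<^sub>R j)"
      by (simp add: euclidean_representation)
    also have "\<dots> = (\<Sum>(i, j)\<in>Basis \<times> Basis. (v \<bullet> i) * (v \<bullet> j) * b i j)"
      unfolding bilinear_sum[OF that]
      by (intro sum.cong) (auto simp: bilinear_lmul[OF that] bilinear_rmul[OF that])
    finally show ?thesis .
  qed
  have "B v v - B' v v = (\<Sum>(i, j)\<in>Basis \<times> Basis. (v \<bullet> i) * (v \<bullet> j) * (B i j - B' i j))"
    unfolding expand[OF assms(1)] expand[OF assms(2)] sum_subtractf[symmetric]
    by (intro sum.cong) (auto simp: algebra_simps)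
  also have "\<bar>\<dots>\<bar> \<le> (\<Sum>(i, j)\<in>Basis \<times> Basis. \<bar>B i j - B' i j\<bar> * (norm v)\<^sup>2)"
  proof (rule sum_abs[THEN order_trans], rule sum_mono, clarify)
    fix i j :: 'e assume "i \<in> Basis" "j \<in> Basis"
    then have "\<bar>v \<bullet> i\<bar> * \<bar>v \<bullet> j\<bar> \<le> norm v * norm v"
      by (intro mult_mono Basis_le_norm) auto
    then show "\<bar>(v \<bullet> i) * (v \<bullet> j) * (B i j - B' i j)\<bar> \<le> \<bar>B i j - B' i j\<bar> * (norm v)\<^sup>2"
      using mult_right_mono[of "\<bar>v \<bullet> i\<bar> * \<bar>v \<bullet> j\<bar>" "norm v * norm v" "\<bar>B i j - B' i j\<bar>"]
      by (simp add: abs_mult power2_eq_square mult.commute)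
  qed
  also have "\<dots> = (\<Sum>(i, j)\<in>Basis \<times> Basis. \<bar>B i j - B' i j\<bar>) * (norm v)\<^sup>2"
    by (simp add: sum_distrib_right split_def)
  finally show ?thesis .
qed

text \<open>Compactness of the unit sphere gives \<open>B z0\<close> a positive lower constant
  \<open>l\<close>, and continuity of the entries changes the form by at most \<open>l / 2\<close>
  near \<open>z0\<close>. It serves both for Hessians depending on \<open>(q, x)\<close> and for the
  metric depending on \<open>x\<close>.\<close>

lemma positive_form_bounds_near:
  fixes B :: "'z::topological_space \<Rightarrow> 'e::euclidean_space \<Rightarrow> 'e \<Rightarrow> real"
  assumes W: "open W" "z0 \<in> W" and bil: "\<And>z. z \<in> W \<Longrightarrow> bilinear (B z)"
    and cont: "\<And>v w. continuous_on W (\<lambda>z. B z v w)" and pos: "\<And>v. v \<noteq> 0 \<Longrightarrow> B z0 v v > 0"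
  obtains N lo hi where "open N" "z0 \<in> N" "N \<subseteq> W" "0 < lo" "0 < hi"
    "\<And>z v. z \<in> N \<Longrightarrow> lo * (norm v)\<^sup>2 \<le> B z v v" "\<And>z v. z \<in> N \<Longrightarrow> B z v v \<le> hi * (norm v)\<^sup>2"
proof -
  note bil0 = bil[OF W(2)]
  obtain K where K: "0 < K" "\<And>v w. \<bar>B z0 v w\<bar> \<le> K * norm v * norm w"
    using bilinear_bounded_pos[OF bil0] by (auto simp: real_norm_def)
  have "continuous_on (sphere 0 1) (\<lambda>v. B z0 v v)"
    using bil0 by (intro bounded_bilinear.continuous_on[of "B z0"]) (auto simp: bilinear_conv_bounded_bilinear)
  \<comment> \<open>By homogeneity the minimum over unit vectors controls the form on all
    vectors.\<close>
  then obtain v0 where v0: "norm v0 = 1" "\<And>v. norm v = 1 \<Longrightarrow> B z0 v0 v0 \<le> B z0 v v"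
    using continuous_attains_inf[of "sphere 0 1" "\<lambda>v. B z0 v v"] by auto
  define l where "l = B z0 v0 v0"
  have l: "0 < l" unfolding l_def using v0 by (intro pos) auto
  have lower: "l * (norm v)\<^sup>2 \<le> B z0 v v" for v
  proof (cases "v = 0")
    case False
    have "l \<le> B z0 ((1 / norm v) *\<^sub>R v) ((1 / norm v) *\<^sub>R v)"
      unfolding l_def using False by (intro v0) auto
    also have "\<dots> = B z0 v v / (norm v)\<^sup>2"
      by (simp only: bilinear_lmul[OF bil0] bilinear_rmul[OF bil0]) (simp add: power2_eq_square)
    finally show ?thesis using False by (simp add: field_simps)
  qed (simp add: bilinear_lzero[OF bil0])
  define e where "e z = (\<Sum>(i, j)\<in>Basis \<times> Basis. \<bar>B z i j - B z0 i j\<bar>)" for z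
  have "continuous_on W e" unfolding e_def split_def
    by (intro continuous_on_sum continuous_on_rabs continuous_on_diff cont continuous_on_const)
  then have N: "open (W \<inter> e -` {..<l / 2})" using W by (intro continuous_open_preimage) auto
  have z0: "z0 \<in> W \<inter> e -` {..<l / 2}" using W l by (simp add: e_def split_def)
  have close: "\<bar>B z v v - B z0 v v\<bar> \<le> l / 2 * (norm v)\<^sup>2" if "z \<in> W \<inter> e -` {..<l / 2}" for z v
  proof -
    have "\<bar>B z v v - B z0 v v\<bar> \<le> e z * (norm v)\<^sup>2"
      unfolding e_def using bil bil0 that by (intro bilinear_diagonal_diff_le) auto
    also have "\<dots> \<le> l / 2 * (norm v)\<^sup>2" using that by (intro mult_right_mono) auto
    finally show ?thesis .
  qed
  show thesis
  proof (rule that[OF N z0, of "l / 2" "K + l / 2"])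
    fix z v assume "z \<in> W \<inter> e -` {..<l / 2}"
    note c = close[OF this, of v]
    show "l / 2 * (norm v)\<^sup>2 \<le> B z v v" using abs_le_D2[OF c] lower[of v] by (simp add: field_simps)
    have "B z0 v v \<le> K * (norm v)\<^sup>2" using K(2)[of v v] by (simp add: power2_eq_square mult.assoc)
    then show "B z v v \<le> (K + l / 2) * (norm v)\<^sup>2" using abs_le_D1[OF c] by (simp add: field_simps)
  qed (use l K in auto)
qed

section \<open>Second-order expansion, uniform in a parameter\<close>

lemma Ck_in_snd_imp_continuous_on:
  "Ck_in_snd k F W \<Longrightarrow> continuous_on W (\<lambda>(q, x). F q x)"
  by (cases k) auto

text \<open>Linearity of \<open>H\<close> in \<open>v\<close> is that of a derivative. Linearity in
  \<open>w\<close> is inherited from the first derivative, which is linear at all points near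
  \<open>x\<close> because \<open>\<Omega>\<close> is open, by uniqueness of derivatives.\<close>

lemma Ck_in_snd_second_derivative:
  fixes F :: "'q::topological_space \<Rightarrow> 'e::euclidean_space \<Rightarrow> real"
  defines "H \<equiv> \<lambda>(q, x) v w. frechet_derivative (\<lambda>y. frechet_derivative (F q) (at y) w) (at x) v"
  assumes "open \<Omega>" and C2: "Ck_in_snd (Suc (Suc k)) F \<Omega>"
  shows "(q, x) \<in> \<Omega> \<Longrightarrow> (F q has_derivative frechet_derivative (F q) (at x)) (at x)"
    and "(q, x) \<in> \<Omega> \<Longrightarrow> ((\<lambda>y. frechet_derivative (F q) (at y) w) has_derivative (\<lambda>v. H (q, x) v w)) (at x)"
    and "continuous_on \<Omega> (\<lambda>z. H z v w)"
    and "z \<in> \<Omega> \<Longrightarrow> bilinear (H z)"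
proof -
  have d1: "(F q has_derivative frechet_derivative (F q) (at x)) (at x)" if "(q, x) \<in> \<Omega>" for q x
    using C2 that by (auto simp flip: frechet_derivative_works)
  then show "(q, x) \<in> \<Omega> \<Longrightarrow> (F q has_derivative frechet_derivative (F q) (at x)) (at x)" .
  have d2: "((\<lambda>y. frechet_derivative (F q) (at y) w) has_derivative (\<lambda>v. H (q, x) v w)) (at x)"
    if "(q, x) \<in> \<Omega>" for q x w
  proof -
    have "(\<lambda>y. frechet_derivative (F q) (at y) w) differentiable (at x)" using C2 that by auto
    then show ?thesis by (simp add: H_def frechet_derivative_works)
  qed
  then show "(q, x) \<in> \<Omega> \<Longrightarrow> ((\<lambda>y. frechet_derivative (F q) (at y) w) has_derivative (\<lambda>v. H (q, x) v w)) (at x)" .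
  have "Ck_in_snd k (\<lambda>q x. H (q, x) v w) \<Omega>" using C2 by (simp add: H_def)
  then show "continuous_on \<Omega> (\<lambda>z. H z v w)" using Ck_in_snd_imp_continuous_on by (fastforce simp: split_def)
  show "bilinear (H z)" if "z \<in> \<Omega>" for z
  proof -
    obtain q x where z: "z = (q, x)" by (cases z)
    have "continuous_on UNIV (\<lambda>y. (q, y))" by (intro continuous_intros)
    then have "open (Pair q -` \<Omega>)" using \<open>open \<Omega>\<close> by (intro open_vimage)
    then have near: "\<forall>\<^sub>F y in nhds x. (q, y) \<in> \<Omega>" using that z by (auto simp: eventually_nhds)
    have lin: "linear (frechet_derivative (F q) (at y))" if "(q, y) \<in> \<Omega>" for y
      using d1[OF that] by (rule has_derivative_linear)
    have 1: "linear (\<lambda>v. H z v w)" for w using d2[of q x w] that z by (auto dest: has_derivative_linear)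
    have 2: "H z v (w + w') = H z v w + H z v w'" for v w w'
    proof -
      have "((\<lambda>y. frechet_derivative (F q) (at y) w + frechet_derivative (F q) (at y) w')
          has_derivative (\<lambda>v. H z v w + H z v w')) (at x)"
        using that z by (auto intro!: has_derivative_add d2)
      then have "((\<lambda>y. frechet_derivative (F q) (at y) (w + w')) has_derivative (\<lambda>v. H z v w + H z v w')) (at x)"
        by (rule has_derivative_transform_eventually)
          (use near that z lin in \<open>auto simp: linear_add eventually_at_filter elim!: eventually_mono\<close>)
      from has_derivative_unique[OF this d2] that z show ?thesis by metis
    qed
    have 3: "H z v (r *\<^sub>R w) = r *\<^sub>R H z v w" for v w r
    proof -
      have "((\<lambda>y. r *\<^sub>R frechet_derivative (F q) (at y) w) has_derivative (\<lambda>v. r *\<^sub>R H z v w)) (at x)"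
        using that z by (intro has_derivative_scaleR_right) (auto intro!: d2)
      then have "((\<lambda>y. frechet_derivative (F q) (at y) (r *\<^sub>R w)) has_derivative (\<lambda>v. r *\<^sub>R H z v w)) (at x)"
        by (rule has_derivative_transform_eventually)
          (use near that z lin in \<open>auto simp: linear_cmul eventually_at_filter elim!: eventually_mono\<close>)
      from has_derivative_unique[OF this d2] that z show ?thesis by metis
    qed
    show ?thesis unfolding bilinear_def using 1 2 3 by (auto intro!: linearI)
  qed
qed

text \<open>A zero \<open>y\<close> of the nonnegative \<open>F q\<close> is a minimum, so the
  expansion at \<open>y\<close> along the segment to \<open>x\<close> leaves only the Hessian term
  at an intermediate point. The point \<open>y\<close> is allowed to vary because the minimizer
  moves with \<open>q\<close>.\<close>

lemma quadratic_growth_near_minimum: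
  fixes F :: "'q::topological_space \<Rightarrow> 'e::euclidean_space \<Rightarrow> real"
  assumes \<Omega>: "open \<Omega>" "(q0, x0) \<in> \<Omega>" and C2: "Ck_in_snd (Suc (Suc k)) F \<Omega>"
    and nonneg: "\<And>q x. 0 \<le> F q x"
    and pos: "\<And>v. v \<noteq> 0 \<Longrightarrow> frechet_derivative (\<lambda>y. frechet_derivative (F q0) (at y) v) (at x0) v > 0"
  obtains U R lo hi where "open U" "q0 \<in> U" "0 < R" "0 < lo" "0 < hi"
    "\<forall>q\<in>U. \<forall>x\<in>ball x0 R. \<forall>y\<in>ball x0 R. F q y = 0 \<longrightarrow>
       lo * (norm (x - y))\<^sup>2 \<le> F q x \<and> F q x \<le> hi * (norm (x - y))\<^sup>2"
proof -
  define H where "H = (\<lambda>(q, x) v w. frechet_derivative (\<lambda>y. frechet_derivative (F q) (at y) w) (at x) v)"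
  note facts = Ck_in_snd_second_derivative[OF \<Omega>(1) C2, folded H_def]
  obtain N lo hi where N: "open N" "(q0, x0) \<in> N" "N \<subseteq> \<Omega>" "0 < lo" "0 < hi"
    "\<And>z v. z \<in> N \<Longrightarrow> lo * (norm v)\<^sup>2 \<le> H z v v" "\<And>z v. z \<in> N \<Longrightarrow> H z v v \<le> hi * (norm v)\<^sup>2"
  proof (rule positive_form_bounds_near[OF \<Omega>, of H])
    show "H (q0, x0) v v > 0" if "v \<noteq> 0" for v using pos[OF that] by (simp add: H_def)
  qed (use facts in auto)
  \<comment> \<open>A product neighbourhood with a convex second factor: for every \<open>q\<close>
    in \<open>U\<close>, segments in the ball stay where the Hessian is controlled.\<close>
  obtain U V where UV: "open U" "q0 \<in> U" "open V" "x0 \<in> V" "U \<times> V \<subseteq> N"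
    using N(1,2) by (elim open_prod_elim) auto
  obtain R where R: "0 < R" "ball x0 R \<subseteq> V" using UV openE by blast
  show thesis
  proof (rule that[of U R "lo / 2" "hi / 2"], goal_cases)
    case 6
    show ?case
    proof (intro ballI impI)
      fix q x y assume q: "q \<in> U" and x: "x \<in> ball x0 R" and y: "y \<in> ball x0 R" and zero: "F q y = 0"
      define v where "v = x - y"
      define l where "l t = y + t *\<^sub>R v" for t :: real
      have l: "(q, l t) \<in> N" if "0 \<le> t" "t \<le> 1" for t
      proof -
        have "l t = (1 - t) *\<^sub>R y + t *\<^sub>R x" by (simp add: l_def v_def algebra_simps)
        also have "\<dots> \<in> ball x0 R" using x y that by (intro convexD[OF convex_ball]) auto
        finally show ?thesis using q UV R by auto
      qed
      have l\<Omega>: "(q, l t) \<in> \<Omega>" if "0 \<le> t" "t \<le> 1" for t using l[OF that] N by auto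
      have dl: "(l has_derivative (\<lambda>s. s *\<^sub>R v)) (at t)" for t
        unfolding l_def by (auto intro!: derivative_eq_intros)
      \<comment> \<open>The restriction of \<open>F q\<close> to the segment and its first two
        derivatives, as the one-variable Taylor formula expects them.\<close>
      define diff where "diff n = (if n = (0::nat) then (\<lambda>t. F q (l t)) else if n = 1
          then (\<lambda>t. frechet_derivative (F q) (at (l t)) v) else (\<lambda>t. H (q, l t) v v))" for n
      have "\<exists>t. 0 < t \<and> t \<le> 1 \<and> F q (l 1) = (\<Sum>m<2. diff m 0 / fact m * 1 ^ m) + diff 2 t / fact 2 * 1 ^ 2"
      proof (rule Maclaurin2)
        show "\<forall>m t. m < 2 \<and> 0 \<le> t \<and> t \<le> 1 \<longrightarrow> (diff m has_real_derivative diff (Suc m) t) (at t)"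
        proof clarify
          fix m :: nat and t :: real assume m: "m < 2" and t: "0 \<le> t" "t \<le> 1"
          note lin = has_derivative_linear[THEN linear_cmul]
          consider "m = 0" | "m = 1" using m by linarith
          then show "(diff m has_real_derivative diff (Suc m) t) (at t)"
          proof cases
            case 1
            note d = facts(1)[OF l\<Omega>[OF t]]
            have "((\<lambda>t. F q (l t)) has_derivative (\<lambda>s. frechet_derivative (F q) (at (l t)) (s *\<^sub>R v))) (at t)"
              using d by (rule has_derivative_compose[OF dl])
            then show ?thesis using 1 lin[OF d]
              by (simp add: diff_def has_field_derivative_def mult_commute_abs)
          next
            case 2
            note d = facts(2)[OF l\<Omega>[OF t], of v]
            have "((\<lambda>t. frechet_derivative (F q) (at (l t)) v) has_derivative (\<lambda>s. H (q, l t) (s *\<^sub>R v) v)) (at t)"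
              using d by (rule has_derivative_compose[OF dl])
            then show ?thesis using 2 lin[OF d]
              by (simp add: diff_def has_field_derivative_def mult_commute_abs)
          qed
        qed
      qed (auto simp: diff_def)
      then obtain t where t: "0 < t" "t \<le> 1"
        and eq: "F q (l 1) = diff 0 0 + diff 1 0 + diff 2 t / 2"
        by (auto simp: numeral_2_eq_2)
      have d0: "(F q has_derivative frechet_derivative (F q) (at y)) (at y)"
        using facts(1)[OF l\<Omega>[of 0]] by (simp add: l_def)
      \<comment> \<open>The linear term of the expansion vanishes at a minimum.\<close>
      have "frechet_derivative (F q) (at y) = (\<lambda>v. 0)"
        by (rule differential_zero_maxmin[OF _ open_UNIV d0]) (auto simp: zero nonneg)
      then have "F q x = H (q, l t) v v / 2"
        using eq zero by (simp add: diff_def l_def v_def)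
      then show "lo / 2 * (norm (x - y))\<^sup>2 \<le> F q x \<and> F q x \<le> hi / 2 * (norm (x - y))\<^sup>2"
        using N(6,7)[OF l[of t], of v] t by (simp add: v_def)
    qed
  qed (use UV R N in auto)
qed

section \<open>Geodesic distance in a chart\<close>

text \<open>If the integral is infinite nothing is to be shown; otherwise the derivative is
  integrable, and the fundamental theorem of calculus with finitely many exceptional points
  applies.\<close>

lemma norm_diff_le_nn_integral:
  fixes h :: "real \<Rightarrow> 'e::euclidean_space"
  assumes "finite F" "a \<le> b" and h: "continuous_on {a..b} h"
    and der: "\<And>t. t \<in> {a<..<b} - F \<Longrightarrow> (h has_vector_derivative h' t) (at t)"
    and h': "continuous_on ({a<..<b} - F) h'"
  shows "ennreal (norm (h b - h a)) \<le> (\<integral>\<^sup>+t\<in>{a<..<b} - F. ennreal (norm (h' t)) \<partial>lborel)"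
proof (cases "(\<integral>\<^sup>+t\<in>{a<..<b} - F. ennreal (norm (h' t)) \<partial>lborel) = \<infinity>")
  case False
  let ?X = "{a<..<b} - F"
  \<comment> \<open>Extension by zero makes the derivative Borel measurable on the whole line, as it
    is continuous on the Borel set \<open>?X\<close>.\<close>
  define f where "f t = indicator ?X t *\<^sub>R h' t" for t
  have "?X \<in> sets borel" using \<open>finite F\<close> by (intro borel_open open_Diff finite_imp_closed) auto
  then have meas: "f \<in> borel_measurable lborel"
    unfolding f_def using borel_measurable_continuous_on_indicator[OF _ h'] by simp
  have eq: "(\<integral>\<^sup>+t. ennreal (norm (f t)) \<partial>lborel) = (\<integral>\<^sup>+t\<in>?X. ennreal (norm (h' t)) \<partial>lborel)"
    by (intro nn_integral_cong) (auto simp: f_def split: split_indicator)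
  have int: "integrable lborel f"
    unfolding integrable_iff_bounded using meas False by (simp add: eq less_top)
  have "(f has_integral (h b - h a)) {a..b}"
    using assms by (intro fundamental_theorem_of_calculus_interior_strong[of F]) (auto simp: f_def)
  then have "(f has_integral (h b - h a)) UNIV"
    by (rule has_integral_on_superset) (auto simp: f_def)
  then have "integral\<^sup>L lborel f = h b - h a"
    using has_integral_integral_lborel[OF int] has_integral_unique by blast
  then have "norm (h b - h a) \<le> (LINT t|lborel. norm (f t))"
    using integral_norm_bound[of lborel f] by simp
  then have "ennreal (norm (h b - h a)) \<le> ennreal (LINT t|lborel. norm (f t))"
    by (rule ennreal_leI)
  also have "\<dots> = (\<integral>\<^sup>+t. ennreal (norm (f t)) \<partial>lborel)"
    using int by (intro nn_integral_eq_integral[symmetric]) auto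
  finally show ?thesis by (simp only: eq)
qed simp

section \<open>Charts, transition maps and lengths of curves\<close>

lemma
  assumes "smooth_atlas A" "c \<in> A"
  shows chart_open: "open (fst c)" "open (chart_image c)"
    and chart_homeomorphism: "homeomorphism (fst c) (chart_image c) (snd c) (chart_inv c)"
  using assms by (auto simp: smooth_atlas_def)

lemma smooth_on_has_derivative:
  assumes "smooth_on f S" "x \<in> S"
  shows "(f has_derivative frechet_derivative f (at x)) (at x)"
proof -
  have "Ck_on (Suc 0) f S" using assms by (simp only: smooth_on_def)
  then show ?thesis using assms by (auto simp flip: frechet_derivative_works)
qed

lemma smooth_on_continuous_derivative:
  assumes "smooth_on f S"
  shows "continuous_on S (\<lambda>x. frechet_derivative f (at x) v)"
proof -
  have "Ck_on (Suc 0) f S" using assms by (simp only: smooth_on_def)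
  then show ?thesis by simp
qed

lemma smooth_on_imp_continuous_on: "smooth_on f S \<Longrightarrow> continuous_on S f"
  unfolding smooth_on_def by (metis Ck_on.simps(1))

text \<open>The speed is defined through some arbitrarily selected chart \<open>c'\<close>. The
  transition map carries the velocity from \<open>c\<close> to \<open>c'\<close>, and the
  transformation rule of \<open>g\<close> equates the two norms.\<close>

lemma curve_speed_in_chart:
  fixes A :: "('m::metric_space, 'e::euclidean_space) chart set"
  assumes atlas: "smooth_atlas A" and metric: "riemannian_metric A g" and c: "c \<in> A"
    and T: "open T" "t \<in> T" "continuous_on T \<gamma>" and in_c: "\<gamma> t \<in> fst c"
    and der: "((snd c \<circ> \<gamma>) has_vector_derivative v) (at t)"
  shows "curve_speed A g \<gamma> t = sqrt (g c (snd c (\<gamma> t)) v v)"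
proof -
  define c' where "c' = (SOME c. c \<in> A \<and> \<gamma> t \<in> fst c)"
  have c': "c' \<in> A" "\<gamma> t \<in> fst c'" using someI[of "\<lambda>c. c \<in> A \<and> \<gamma> t \<in> fst c" c] c in_c by (auto simp: c'_def)
  define tr where "tr = snd c' \<circ> chart_inv c"
  define x where "x = snd c (\<gamma> t)"
  have x: "x \<in> snd c ` (fst c \<inter> fst c')" using in_c c' by (auto simp: x_def)
  have inv: "chart_inv c (snd c p) = p" if "p \<in> fst c" for p
    using homeomorphism_apply1[OF chart_homeomorphism[OF atlas c] that] .
  have "smooth_on tr (snd c ` (fst c \<inter> fst c'))" using atlas c c' by (auto simp: smooth_atlas_def tr_def)
  then have dtr: "(tr has_derivative frechet_derivative tr (at x)) (at x)" using x by (rule smooth_on_has_derivative)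
  have "((tr \<circ> (snd c \<circ> \<gamma>)) has_vector_derivative frechet_derivative tr (at x) v) (at t)"
    using vector_derivative_diff_chain_within[of "snd c \<circ> \<gamma>" v t UNIV tr] der has_derivative_at_withinI[OF dtr]
    by (simp add: x_def)
  \<comment> \<open>The two coordinate expressions of the curve agree only while it runs in both
    charts; these times form an open set, which is enough for the derivative.\<close>
  moreover have "open (T \<inter> \<gamma> -` (fst c \<inter> fst c'))"
    using T atlas c c' by (intro continuous_open_preimage open_Int chart_open) auto
  ultimately have "((snd c' \<circ> \<gamma>) has_vector_derivative frechet_derivative tr (at x) v) (at t)"
    by (rule has_vector_derivative_transform_within_open) (use T in_c c' inv in \<open>auto simp: tr_def\<close>)
  then have v: "vector_derivative (snd c' \<circ> \<gamma>) (at t) = frechet_derivative tr (at x) v"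
    by (rule vector_derivative_at)
  have "g c x v v = g c' (tr x) (frechet_derivative tr (at x) v) (frechet_derivative tr (at x) v)"
    using metric c c' x unfolding riemannian_metric_def Let_def tr_def by blast
  moreover have "tr x = snd c' (\<gamma> t)" using inv in_c by (simp add: tr_def x_def)
  ultimately show ?thesis by (simp add: curve_speed_def c'_def[symmetric] v x_def Let_def)
qed

text \<open>The test curve is the straight coordinate segment, which convexity keeps inside
  \<open>B\<close>; its speed is at most \<open>sqrt hi * norm (x - y)\<close>.\<close>

lemma geodesic_dist_le_chart:
  fixes A :: "('m::metric_space, 'e::euclidean_space) chart set"
  assumes atlas: "smooth_atlas A" and metric: "riemannian_metric A g" and c: "c \<in> A"
    and B: "convex B" "B \<subseteq> chart_image c" and "0 \<le> hi"
    and hi: "\<And>x v. x \<in> B \<Longrightarrow> g c x v v \<le> hi * (norm v)\<^sup>2"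
    and x: "x \<in> B" and y: "y \<in> B"
  shows "geodesic_dist A g (chart_inv c x) (chart_inv c y) \<le> ennreal (sqrt hi * norm (x - y))"
proof -
  note hom = chart_homeomorphism[OF atlas c]
  define v where "v = y - x"
  define l where "l t = x + t *\<^sub>R v" for t :: real
  define \<gamma> where "\<gamma> = chart_inv c \<circ> l"
  have lB: "l t \<in> B" if "0 \<le> t" "t \<le> 1" for t
  proof -
    have "l t = (1 - t) *\<^sub>R x + t *\<^sub>R y" by (simp add: l_def v_def algebra_simps)
    also have "\<dots> \<in> B" using x y that by (intro convexD[OF B(1)]) auto
    finally show ?thesis .
  qed
  have dl: "(l has_vector_derivative v) (at t)" for t
    unfolding l_def by (auto intro!: derivative_eq_intros)
  have lcont: "continuous_on X l" for X unfolding l_def by (intro continuous_intros)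
  have snd_\<gamma>: "snd c (\<gamma> t) = l t" "\<gamma> t \<in> fst c" if "0 \<le> t" "t \<le> 1" for t
    using hom lB[OF that] B(2) unfolding \<gamma>_def homeomorphism_def comp_def by blast+
  have \<gamma>cont: "continuous_on {0..1} \<gamma>" unfolding \<gamma>_def
    using lB B(2) by (intro continuous_on_compose lcont continuous_on_subset[OF homeomorphism_cont2[OF hom]]) auto
  \<comment> \<open>In any other chart the segment becomes a transition map composed with an affine
    map, so no exceptional times are needed.\<close>
  have C1: "(snd c' \<circ> \<gamma>) C1_differentiable_on ({t\<in>{0<..<1}. \<gamma> t \<in> fst c'} - {})" if c': "c' \<in> A" for c'
  proof -
    let ?ov = "snd c ` (fst c \<inter> fst c')"
    define tr where "tr = snd c' \<circ> chart_inv c"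
    have smooth: "smooth_on tr ?ov" using atlas c c' by (auto simp: smooth_atlas_def tr_def)
    have ov: "l t \<in> ?ov" if "0 < t" "t < 1" "\<gamma> t \<in> fst c'" for t
      using snd_\<gamma>[of t] that by (metis IntI image_eqI less_imp_le)
    have "((snd c' \<circ> \<gamma>) has_vector_derivative frechet_derivative tr (at (l t)) v) (at t)"
      if "0 < t" "t < 1" "\<gamma> t \<in> fst c'" for t
      using vector_derivative_diff_chain_within[of l v t UNIV tr] dl
        has_derivative_at_withinI[OF smooth_on_has_derivative[OF smooth ov[OF that]]]
      by (simp add: tr_def \<gamma>_def comp_assoc)
    moreover have "continuous_on {t\<in>{0<..<1}. \<gamma> t \<in> fst c'} (\<lambda>t. frechet_derivative tr (at (l t)) v)"
      by (rule continuous_on_compose2[OF smooth_on_continuous_derivative[OF smooth] lcont]) (use ov in auto)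
    ultimately show ?thesis unfolding C1_differentiable_on_def
      by (intro exI[of _ "\<lambda>t. frechet_derivative tr (at (l t)) v"]) auto
  qed
  have "path_image \<gamma> \<subseteq> \<Union> (fst ` A)" using snd_\<gamma>(2) c by (auto simp: path_image_def)
  then have "pw_C1_curve A \<gamma>" using C1 \<gamma>cont unfolding pw_C1_curve_def path_def by blast
  moreover have "pathstart \<gamma> = chart_inv c x" "pathfinish \<gamma> = chart_inv c y"
    by (auto simp: pathstart_def pathfinish_def \<gamma>_def l_def v_def)
  ultimately have "geodesic_dist A g (chart_inv c x) (chart_inv c y) \<le> curve_length A g \<gamma>"
    unfolding geodesic_dist_def by (intro INF_lower) auto
  also have "\<dots> \<le> (\<integral>\<^sup>+t\<in>{0..1::real}. ennreal (sqrt hi * norm v) \<partial>lborel)"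
    unfolding curve_length_def
  proof (rule nn_integral_mono_AE)
    have speed: "curve_speed A g \<gamma> t \<le> sqrt hi * norm v" if t: "0 < t" "t < 1" for t
    proof -
      have d: "((snd c \<circ> \<gamma>) has_vector_derivative v) (at t)"
        by (rule has_vector_derivative_transform_within_open[OF dl, of "{0<..<1}"]) (use t snd_\<gamma> in auto)
      have "continuous_on {0<..<1} \<gamma>" using \<gamma>cont by (rule continuous_on_subset) auto
      then have "curve_speed A g \<gamma> t = sqrt (g c (l t) v v)"
        using curve_speed_in_chart[OF atlas metric c _ _ _ _ d, of "{0<..<1}"] snd_\<gamma>[of t] t by simp
      also have "\<dots> \<le> sqrt (hi * (norm v)\<^sup>2)" using lB t by (intro real_sqrt_le_mono hi) auto
      finally show ?thesis by (simp add: real_sqrt_mult)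
    qed
    \<comment> \<open>The speed involves two-sided derivatives and is therefore controlled only at
      interior times; the endpoints are negligible.\<close>
    have "AE t in lborel. t \<notin> {0, 1::real}" by (intro AE_not_in finite_imp_null_set_lborel) simp
    then show "AE t in lborel. ennreal (curve_speed A g \<gamma> t) * indicator {0..1} t
        \<le> ennreal (sqrt hi * norm v) * indicator {0..1} t"
    proof eventually_elim
      case (elim t)
      then show ?case using speed[of t] by (auto split: split_indicator intro: ennreal_leI)
    qed
  qed
  also have "\<dots> = ennreal (sqrt hi * norm v)" by (simp add: nn_integral_cmult_indicator)
  finally show ?thesis by (simp add: v_def norm_minus_commute)
qed

text \<open>A curve between two points close to the centre of a coordinate ball either stays in the ball or
  crosses it; both force its length to be comparable to the coordinate distance.\<close>

lemma geodesic_dist_ge_chart: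
  fixes A :: "('m::metric_space, 'e::euclidean_space) chart set"
  assumes atlas: "smooth_atlas A" and metric: "riemannian_metric A g" and c: "c \<in> A"
    and R: "0 < R" "cball x0 R \<subseteq> chart_image c" and "0 \<le> lo"
    and lo: "\<And>x v. x \<in> cball x0 R \<Longrightarrow> lo * (norm v)\<^sup>2 \<le> g c x v v"
    and x: "x \<in> ball x0 (R / 2)" and y: "y \<in> ball x0 (R / 2)"
  shows "ennreal (sqrt lo * norm (x - y) / 2) \<le> geodesic_dist A g (chart_inv c x) (chart_inv c y)"
  unfolding geodesic_dist_def
proof (rule INF_greatest, clarify)
  fix \<gamma> assume \<gamma>: "pw_C1_curve A \<gamma>" and start: "pathstart \<gamma> = chart_inv c x"
    and finish: "pathfinish \<gamma> = chart_inv c y"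
  note hom = chart_homeomorphism[OF atlas c]
  have \<gamma>cont: "continuous_on {0..1} \<gamma>" using \<gamma> by (simp add: pw_C1_curve_def path_def)
  \<comment> \<open>The open ball \<open>Kb\<close> defines the exit time. The closed ball
    \<open>Kc\<close> is the image of a compact set, hence closed in the whole space, and keeps the
    exit point in the chart.\<close>
  define Kb where "Kb = fst c \<inter> snd c -` ball x0 R"
  define Kc where "Kc = chart_inv c ` cball x0 R"
  define h where "h = snd c \<circ> \<gamma>"
  have Kb: "open Kb" unfolding Kb_def
    using chart_open[OF atlas c] homeomorphism_cont1[OF hom] by (intro continuous_open_preimage) auto
  have "compact Kc" unfolding Kc_def
    by (intro compact_continuous_image compact_cball continuous_on_subset[OF homeomorphism_cont2[OF hom]] R)
  then have Kc: "closed Kc" by (rule compact_imp_closed)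
  have Kc_iff: "p \<in> Kc \<longleftrightarrow> p \<in> fst c \<and> snd c p \<in> cball x0 R" for p
    using hom R(2) unfolding Kc_def homeomorphism_def by (force simp: image_iff)
  have KbKc: "Kb \<subseteq> Kc" by (auto simp: Kc_iff Kb_def less_imp_le)
  have in_im: "x \<in> chart_image c" "y \<in> chart_image c" using x y R by auto
  then have h01: "h 0 = x" "h 1 = y"
    using start finish homeomorphism_apply2[OF hom] by (auto simp: h_def pathstart_def pathfinish_def)
  have \<gamma>0: "\<gamma> 0 \<in> Kb"
    using start in_im x R hom unfolding Kb_def by (auto simp: pathstart_def homeomorphism_def)
  \<comment> \<open>\<open>T\<close> is 1 if the curve stays in the open ball and the first exit
    time otherwise. Either way the coordinate displacement up to \<open>T\<close> is at least half
    of \<open>norm (x - y)\<close>.\<close>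
  obtain T where T: "0 \<le> T" "T \<le> 1" "\<And>t. 0 \<le> t \<Longrightarrow> t \<le> T \<Longrightarrow> \<gamma> t \<in> Kc"
    and far: "norm (x - y) / 2 \<le> norm (h T - x)"
  proof (cases "\<forall>t\<in>{0..1}. \<gamma> t \<in> Kb")
    case True
    then have "\<gamma> t \<in> Kc" if "0 \<le> t" "t \<le> 1" for t using KbKc that by auto
    then show thesis using that[of 1] h01 by (simp add: norm_minus_commute)
  next
    case False
    define X where "X = {0..1} \<inter> \<gamma> -` (- Kb)"
    have "closed X" unfolding X_def
      using Kb by (intro continuous_closed_preimage \<gamma>cont) auto
    moreover have "X \<noteq> {}" "bdd_below X" using False by (auto simp: X_def intro: bdd_belowI[of _ 0])
    ultimately have TX: "Inf X \<in> X" by (intro closed_contains_Inf)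
    define T where "T = Inf X"
    have T: "0 \<le> T" "T \<le> 1" "\<gamma> T \<notin> Kb" using TX by (auto simp: X_def T_def)
    have "T \<noteq> 0" using T \<gamma>0 by metis
    have less: "\<gamma> t \<in> Kb" if "0 \<le> t" "t < T" for t
    proof (rule ccontr)
      assume "\<gamma> t \<notin> Kb"
      then have "t \<in> X" using that T by (auto simp: X_def)
      then have "T \<le> t" unfolding T_def using \<open>bdd_below X\<close> by (rule cInf_lower)
      with that show False by simp
    qed
    have "closed ({0..T} \<inter> \<gamma> -` Kc)"
      using T by (intro continuous_closed_preimage continuous_on_subset[OF \<gamma>cont] Kc) auto
    moreover have "{0..<T} \<subseteq> {0..T} \<inter> \<gamma> -` Kc" using less subsetD[OF KbKc] by auto
    \<comment> \<open>The exit point is a limit of points of \<open>Kb\<close>, so it still lies in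
      \<open>Kc\<close> and has coordinates in \<open>c\<close>.\<close>
    ultimately have "closure {0..<T} \<subseteq> {0..T} \<inter> \<gamma> -` Kc" by (intro closure_minimal)
    then have Kc_T: "\<gamma> t \<in> Kc" if "0 \<le> t" "t \<le> T" for t
      using that T \<open>T \<noteq> 0\<close> by (auto simp: closure_atLeastLessThan)
    \<comment> \<open>From within \<open>R / 2\<close> of the centre the curve has reached distance
      \<open>R\<close>, a displacement of at least \<open>R / 2\<close>, whereas \<open>x\<close>
      and \<open>y\<close> are at most \<open>R\<close> apart. This is the source of the factor
      1/2.\<close>
    have "R \<le> norm (h T - x0)"
      using T(3) Kc_T[of T] T by (auto simp: Kc_iff Kb_def h_def dist_norm norm_minus_commute)
    also have "\<dots> \<le> norm (h T - x) + norm (x - x0)" using norm_triangle_ineq[of "h T - x" "x - x0"] by simp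
    also have "norm (x - x0) \<le> R / 2" using x by (simp add: dist_norm norm_minus_commute)
    finally have 1: "R / 2 \<le> norm (h T - x)" by simp
    have "norm (x - y) \<le> R" using x y norm_triangle_le_diff[of "x - x0" "y - x0" R] by (simp add: dist_norm norm_minus_commute)
    with that[of T] T Kc_T 1 show thesis by auto
  qed
  obtain F where F: "finite F" "h C1_differentiable_on ({t\<in>{0<..<1}. \<gamma> t \<in> fst c} - F)"
    using \<gamma> c unfolding pw_C1_curve_def h_def by blast
  then obtain h' where h': "\<And>t. t \<in> {t\<in>{0<..<1}. \<gamma> t \<in> fst c} - F \<Longrightarrow> (h has_vector_derivative h' t) (at t)"
      "continuous_on ({t\<in>{0<..<1}. \<gamma> t \<in> fst c} - F) h'"
    unfolding C1_differentiable_on_def by blast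
  let ?X = "{0<..<T} - F"
  have X: "?X \<subseteq> {t\<in>{0<..<1}. \<gamma> t \<in> fst c} - F" using T Kc_iff by fastforce
  have hcont: "continuous_on {0..T} h" unfolding h_def
    using T Kc_iff by (intro continuous_on_compose continuous_on_subset[OF \<gamma>cont]
        continuous_on_subset[OF homeomorphism_cont1[OF hom]]) auto
  \<comment> \<open>Scaling the curve by \<open>sqrt lo\<close> beforehand puts the norm of its
    derivative directly below the Riemannian speed.\<close>
  have "ennreal (sqrt lo * norm (x - y) / 2) \<le> ennreal (norm (sqrt lo *\<^sub>R h T - sqrt lo *\<^sub>R h 0))"
    using far \<open>0 \<le> lo\<close> h01 mult_left_mono[OF far, of "sqrt lo"]
    by (intro ennreal_leI) (simp flip: scaleR_diff_right)
  also have "\<dots> \<le> (\<integral>\<^sup>+t\<in>?X. ennreal (norm (sqrt lo *\<^sub>R h' t)) \<partial>lborel)"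
  proof (rule norm_diff_le_nn_integral[OF F(1) T(1)])
    show "((\<lambda>t. sqrt lo *\<^sub>R h t) has_vector_derivative sqrt lo *\<^sub>R h' t) (at t)" if "t \<in> ?X" for t
      using h'(1)[of t] X that bounded_linear.has_vector_derivative[OF bounded_linear_scaleR_right] by blast
  qed (intro continuous_intros hcont continuous_on_subset[OF h'(2) X])+
  also have "\<dots> \<le> curve_length A g \<gamma>" unfolding curve_length_def
  proof (rule nn_integral_mono)
    fix t :: real
    have "norm (sqrt lo *\<^sub>R h' t) \<le> curve_speed A g \<gamma> t" if t: "t \<in> ?X"
    proof -
      have t': "\<gamma> t \<in> Kc" using t T by auto
      have "continuous_on {0<..<1} \<gamma>" using \<gamma>cont by (rule continuous_on_subset) auto
      then have "curve_speed A g \<gamma> t = sqrt (g c (snd c (\<gamma> t)) (h' t) (h' t))"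
        using h'(1)[of t] X t T t' Kc_iff
        by (intro curve_speed_in_chart[OF atlas metric c open_greaterThanLessThan]) (auto simp: h_def)
      moreover have "sqrt (lo * (norm (h' t))\<^sup>2) \<le> sqrt (g c (snd c (\<gamma> t)) (h' t) (h' t))"
        using t' Kc_iff by (intro real_sqrt_le_mono lo) auto
      ultimately show ?thesis using \<open>0 \<le> lo\<close> by (simp add: real_sqrt_mult)
    qed
    then show "ennreal (norm (sqrt lo *\<^sub>R h' t)) * indicator ?X t
        \<le> ennreal (curve_speed A g \<gamma> t) * indicator {0..1} t"
      using T by (auto split: split_indicator intro: ennreal_leI)
  qed
  finally show "ennreal (sqrt lo * norm (x - y) / 2) \<le> curve_length A g \<gamma>" .
qed

text \<open>Near \<open>p\<close> the metric coefficients lie between positive multiples of the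
  Euclidean form, so the two length estimates apply, and \<open>W\<close> identifies the geodesic
  distance with \<open>dist\<close>.\<close>

lemma dist_comparable_in_chart:
  fixes A :: "('m::metric_space, 'e::euclidean_space) chart set"
  assumes atlas: "smooth_atlas A" and metric: "riemannian_metric A g" and c: "c \<in> A" and p: "p \<in> fst c"
    and W: "open W" "p \<in> W" "\<forall>x\<in>W. \<forall>y\<in>W. geodesic_dist A g x y = ennreal (dist x y)"
  obtains R K where "0 < R" "0 < K" "ball (snd c p) R \<subseteq> chart_image c"
    "\<forall>x\<in>ball (snd c p) R. \<forall>y\<in>ball (snd c p) R.
       norm (x - y) \<le> K * dist (chart_inv c x) (chart_inv c y) \<and>
       dist (chart_inv c x) (chart_inv c y) \<le> K * norm (x - y)"
proof -
  note hom = chart_homeomorphism[OF atlas c]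
  have x0: "snd c p \<in> chart_image c" using p by (simp add: chart_image_def)
  obtain N lo hi where N: "open N" "snd c p \<in> N" "N \<subseteq> chart_image c" "0 < lo" "0 < hi"
    "\<And>x v. x \<in> N \<Longrightarrow> lo * (norm v)\<^sup>2 \<le> g c x v v" "\<And>x v. x \<in> N \<Longrightarrow> g c x v v \<le> hi * (norm v)\<^sup>2"
    using metric c x0
    by (elim positive_form_bounds_near[OF chart_open(2)[OF atlas c] x0, of "g c", rotated 3])
      (auto simp: riemannian_metric_def intro: smooth_on_imp_continuous_on)
  have "open (N \<inter> chart_inv c -` W)"
    using N W homeomorphism_cont2[OF hom] by (intro continuous_open_preimage) (auto intro: continuous_on_subset)
  moreover have "snd c p \<in> N \<inter> chart_inv c -` W" using N W homeomorphism_apply1[OF hom p] by simp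
  ultimately obtain R where R: "0 < R" "cball (snd c p) R \<subseteq> N \<inter> chart_inv c -` W"
    by (meson open_contains_cball)
  have sub: "ball (snd c p) (R / 2) \<subseteq> cball (snd c p) R" using R by auto
  \<comment> \<open>\<open>sqrt hi\<close> comes from the coordinate segment,
    \<open>2 / sqrt lo\<close> from the lower length bound; the latter also requires the endpoints
    to lie in the ball of half the radius.\<close>
  define K where "K = max (sqrt hi) (2 / sqrt lo)"
  show thesis
  proof (rule that[of "R / 2" K], goal_cases)
    case 4
    show ?case
    proof (intro ballI)
      fix x y assume x: "x \<in> ball (snd c p) (R / 2)" and y: "y \<in> ball (snd c p) (R / 2)"
      have xy: "x \<in> cball (snd c p) R" "y \<in> cball (snd c p) R" using x y sub by auto
      then have geo: "geodesic_dist A g (chart_inv c x) (chart_inv c y)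
          = ennreal (dist (chart_inv c x) (chart_inv c y))"
        using R(2) by (intro W(3)[rule_format]) auto
      have "ennreal (sqrt lo * norm (x - y) / 2) \<le> ennreal (dist (chart_inv c x) (chart_inv c y))"
        unfolding geo[symmetric] using R N
        by (intro geodesic_dist_ge_chart[OF atlas metric c R(1) _ _ _ x y]) (auto intro: less_imp_le)
      then have "norm (x - y) \<le> 2 / sqrt lo * dist (chart_inv c x) (chart_inv c y)"
        using N(4) by (simp add: ennreal_le_iff field_simps)
      also have "\<dots> \<le> K * dist (chart_inv c x) (chart_inv c y)"
        unfolding K_def by (intro mult_right_mono) auto
      finally have 1: "norm (x - y) \<le> K * dist (chart_inv c x) (chart_inv c y)" .
      have "ennreal (dist (chart_inv c x) (chart_inv c y)) \<le> ennreal (sqrt hi * norm (x - y))"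
        unfolding geo[symmetric] using R N
        by (intro geodesic_dist_le_chart[OF atlas metric c convex_cball _ _ _ xy]) (auto intro: less_imp_le)
      then have "dist (chart_inv c x) (chart_inv c y) \<le> sqrt hi * norm (x - y)"
        using N(5) by (simp add: ennreal_le_iff)
      also have "\<dots> \<le> K * norm (x - y)" unfolding K_def by (intro mult_right_mono) auto
      finally show "norm (x - y) \<le> K * dist (chart_inv c x) (chart_inv c y) \<and>
         dist (chart_inv c x) (chart_inv c y) \<le> K * norm (x - y)" using 1 by blast
    qed
  qed (use R N sub in \<open>auto simp: K_def less_max_iff_disj\<close>)
qed

section \<open>Distortion and squared distance\<close>

text \<open>The largest local constant of a finite subcover works everywhere, since enlarging a
  constant is harmless for nonnegative functions.\<close>

lemma locally_comparable_imp_comparable: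
  fixes f h :: "'z::topological_space \<Rightarrow> real"
  assumes "compact (UNIV :: 'z set)" and nonneg: "\<And>w. 0 \<le> f w" "\<And>w. 0 \<le> h w"
    and loc: "\<And>z. \<exists>U C. open U \<and> z \<in> U \<and> (\<forall>w\<in>U. f w \<le> C * h w \<and> h w \<le> C * f w)"
  obtains C where "1 \<le> C" "\<And>w. f w \<le> C * h w" "\<And>w. h w \<le> C * f w"
proof -
  obtain U C where U: "\<And>z. open (U z)" "\<And>z. z \<in> U z"
    and C: "\<And>z w. w \<in> U z \<Longrightarrow> f w \<le> C z * h w \<and> h w \<le> C z * f w"
    using loc by metis
  have cov: "UNIV \<subseteq> (\<Union>z\<in>UNIV. U z)" using U(2) by blast
  obtain T where T: "finite T" "UNIV \<subseteq> (\<Union>z\<in>T. U z)"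
    using compactE_image[OF assms(1) U(1) cov] by metis
  define K where "K = Max (insert 1 (C ` T))"
  have K: "1 \<le> K" "\<And>z. z \<in> T \<Longrightarrow> C z \<le> K" using T(1) by (auto simp: K_def)
  have "f w \<le> K * h w \<and> h w \<le> K * f w" for w
  proof -
    obtain z where z: "z \<in> T" "w \<in> U z" using T(2) by blast
    show ?thesis
      using C[OF z(2)] mult_right_mono[OF K(2)[OF z(1)] nonneg(1)[of w]]
        mult_right_mono[OF K(2)[OF z(1)] nonneg(2)[of w]] by linarith
  qed
  with K(1) that show thesis by blast
qed

text \<open>A constant above both ratios at \<open>z\<close> gives strict inequalities there, which
  persist nearby by continuity.\<close>

lemma locally_comparable_if_positive:
  fixes f h :: "'z::topological_space \<Rightarrow> real"
  assumes cont: "continuous_on UNIV f" "continuous_on UNIV h" and pos: "0 < f z" "0 < h z"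
    and nonneg: "\<And>w. 0 \<le> f w" "\<And>w. 0 \<le> h w"
  shows "\<exists>U C. open U \<and> z \<in> U \<and> (\<forall>w\<in>U. f w \<le> C * h w \<and> h w \<le> C * f w)"
proof -
  define C where "C = f z / h z + h z / f z + 1"
  have "open {w. f w < C * h w}" "open {w. h w < C * f w}"
    by (intro open_Collect_less continuous_intros cont)+
  then have "open ({w. f w < C * h w} \<inter> {w. h w < C * f w})" by (rule open_Int)
  moreover have "f z / h z < C" "h z / f z < C" using pos by (auto simp: C_def add_pos_pos)
  then have "z \<in> {w. f w < C * h w} \<inter> {w. h w < C * f w}" using pos by (simp add: pos_divide_less_eq)
  ultimately show ?thesis
    by (intro exI[of _ "{w. f w < C * h w} \<inter> {w. h w < C * f w}"] exI[of _ C]) auto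
qed

section \<open>The oracle map and the comparison near its graph\<close>

text \<open>As \<open>q\<close> tends to \<open>q0\<close>, the value \<open>D q (m q0)\<close>
  tends to 0 and drops below \<open>separation D m \<epsilon>\<close>; then \<open>m q0\<close>
  cannot be \<open>\<epsilon>\<close>-far from \<open>m q\<close>.\<close>

lemma separated_minimizer_continuous:
  fixes D :: "'q::topological_space \<Rightarrow> 'm::metric_space \<Rightarrow> real"
  assumes cont: "continuous_on UNIV (\<lambda>(q, z). D q z)" and zero: "\<And>q. D q (m q) = 0"
    and sep: "\<And>\<epsilon>. \<epsilon> > 0 \<Longrightarrow> separation D m \<epsilon> > 0"
  shows "continuous_on UNIV m"
  unfolding continuous_on_def
proof (intro ballI tendstoI)
  fix q0 :: 'q and \<epsilon> :: real assume "0 < \<epsilon>"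
  have "continuous_on UNIV (\<lambda>q. D q (m q0))"
    using continuous_on_compose2[OF cont, of UNIV "\<lambda>q. (q, m q0)"] by (simp add: continuous_on_Pair)
  then have "((\<lambda>q. ereal (D q (m q0))) \<longlongrightarrow> ereal (D q0 (m q0))) (at q0)"
    by (simp add: continuous_on_def)
  then have "\<forall>\<^sub>F q in at q0. ereal (D q (m q0)) < separation D m \<epsilon>"
    using sep[OF \<open>0 < \<epsilon>\<close>] by (intro order_tendstoD(2)) (auto simp: zero zero_ereal_def)
  then show "\<forall>\<^sub>F q in at q0 within UNIV. dist (m q) (m q0) < \<epsilon>"
  proof eventually_elim
    case (elim q)
    show ?case
    proof (rule ccontr)
      assume "\<not> dist (m q) (m q0) < \<epsilon>"
      then have "separation D m \<epsilon> \<le> ereal (D q (m q0))"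
        unfolding separation_def by (intro INF_lower2[of "(q, m q0)"]) (auto simp: dist_commute)
      with elim show False by simp
    qed
  qed
qed

text \<open>At a minimum the covariant correction of the Hessian vanishes with the differential, so
  the Riemannian Hessian is the coordinate Hessian.\<close>

lemma riem_hessian_at_minimum:
  fixes f :: "'m::metric_space \<Rightarrow> real" and c :: "('m, 'e::euclidean_space) chart"
  assumes "f \<circ> chart_inv c differentiable (at (snd c p))"
    and "\<And>x. (f \<circ> chart_inv c) (snd c p) \<le> (f \<circ> chart_inv c) x"
  shows "riem_hessian g c f p v w = frechet_derivative
    (\<lambda>y. frechet_derivative (f \<circ> chart_inv c) (at y) w) (at (snd c p)) v"
proof -
  have "frechet_derivative (f \<circ> chart_inv c) (at (snd c p)) = (\<lambda>v. 0)"
    using assms by (intro differential_zero_maxmin[OF UNIV_I[of "snd c p"] open_UNIV])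
      (auto simp: frechet_derivative_works)
  then show ?thesis by (simp add: riem_hessian_def coord_hessian_def)
qed

text \<open>In one chart, quadratic growth is applied with the moving zero \<open>y\<close>, the
  coordinates of \<open>m q\<close>, and coordinate distance is exchanged for \<open>dist\<close>.
  Continuity of \<open>m\<close> keeps \<open>m q\<close> in the coordinate ball for
  \<open>q\<close> near \<open>q0\<close>.\<close>

lemma distortion_comparable_near_graph:
  fixes Dbar :: "'q::topological_space \<Rightarrow> 'm::metric_space \<Rightarrow> real"
    and A :: "('m, 'e::euclidean_space) chart set"
  assumes nonneg: "\<And>q z. 0 \<le> Dbar q z" and zero: "\<And>q. Dbar q (m q) = 0"
    and m: "continuous_on UNIV m" and covered: "range m \<subseteq> \<Union> (fst ` A)"
    and atlas: "smooth_atlas A" and metric: "riemannian_metric A g"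
    and geodesic: "dist_geodesic_near A g (range m)" and C3: "C3_near_graph A Dbar m"
    and pos: "\<And>c v. c \<in> A \<Longrightarrow> m q0 \<in> fst c \<Longrightarrow> v \<noteq> 0 \<Longrightarrow> riem_hessian g c (Dbar q0) (m q0) v v > 0"
  shows "\<exists>U C. open U \<and> (q0, m q0) \<in> U \<and> (\<forall>(q, z)\<in>U.
    Dbar q z \<le> C * (dist z (m q))\<^sup>2 \<and> (dist z (m q))\<^sup>2 \<le> C * Dbar q z)"
proof -
  obtain c where c: "c \<in> A" "m q0 \<in> fst c" using covered by blast
  note hom = chart_homeomorphism[OF atlas c(1)]
  have inv: "chart_inv c (snd c z) = z" if "z \<in> fst c" for z using homeomorphism_apply1[OF hom that] .
  define x0 where "x0 = snd c (m q0)"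
  have x0: "x0 \<in> chart_image c" using c by (auto simp: x0_def chart_image_def)
  have "\<exists>W. open W \<and> m q0 \<in> W \<and> (\<forall>x\<in>W. \<forall>y\<in>W. geodesic_dist A g x y = ennreal (dist x y))"
    using geodesic unfolding dist_geodesic_near_def by (rule bspec) simp
  then obtain W where W: "open W" "m q0 \<in> W"
    "\<forall>x\<in>W. \<forall>y\<in>W. geodesic_dist A g x y = ennreal (dist x y)" by (elim exE conjE)
  obtain R1 K where R1: "0 < R1" "0 < K" "ball x0 R1 \<subseteq> chart_image c"
    and dist: "\<forall>x\<in>ball x0 R1. \<forall>y\<in>ball x0 R1.
       norm (x - y) \<le> K * dist (chart_inv c x) (chart_inv c y) \<and>
       dist (chart_inv c x) (chart_inv c y) \<le> K * norm (x - y)"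
    by (rule dist_comparable_in_chart[OF atlas metric c W, folded x0_def])
  \<comment> \<open>\<open>chart_inv\<close> is total, so \<open>F\<close> is a value of
    \<open>Dbar\<close> even outside the chart image and is nonnegative everywhere.\<close>
  define F where "F = (\<lambda>q x. Dbar q (chart_inv c x))"
  have F_eq: "F q = Dbar q \<circ> chart_inv c" for q by (auto simp: F_def)
  obtain W' where W': "open W'" "\<forall>q. (q, m q) \<in> W'"
    "\<forall>c\<in>A. Ck_in_snd 3 (\<lambda>q x. Dbar q (chart_inv c x))
       {(q, x). x \<in> chart_image c \<and> (q, chart_inv c x) \<in> W'}"
    using C3 unfolding C3_near_graph_def by (elim exE conjE)
  define \<Omega> where "\<Omega> = {(q, x). x \<in> chart_image c \<and> (q, chart_inv c x) \<in> W'}"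
  have "continuous_on (UNIV \<times> chart_image c) (\<lambda>z. (fst z :: 'q, chart_inv c (snd z)))"
    by (intro continuous_intros continuous_on_compose2[OF homeomorphism_cont2[OF hom]]) auto
  then have "open ((UNIV \<times> chart_image c) \<inter> (\<lambda>z. (fst z :: 'q, chart_inv c (snd z))) -` W')"
    using W'(1) chart_open[OF atlas c(1)] by (intro continuous_open_preimage open_Times) auto
  also have "(UNIV \<times> chart_image c) \<inter> (\<lambda>z. (fst z :: 'q, chart_inv c (snd z))) -` W' = \<Omega>"
    by (auto simp: \<Omega>_def)
  finally have \<Omega>: "open \<Omega>" .
  have x0\<Omega>: "(q0, x0) \<in> \<Omega>" using x0 W'(2) c by (auto simp: \<Omega>_def x0_def inv)
  have C2: "Ck_in_snd (Suc (Suc 1)) F \<Omega>" using bspec[OF W'(3) c(1)] by (simp only: F_def \<Omega>_def numeral_3_eq_3 One_nat_def)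
  have hess: "frechet_derivative (\<lambda>y. frechet_derivative (F q0) (at y) v) (at x0) v > 0" if "v \<noteq> 0" for v
  proof -
    have "F q0 differentiable (at x0)"
      using Ck_in_snd_second_derivative(1)[OF \<Omega> C2 x0\<Omega>] by (rule differentiableI)
    then have "riem_hessian g c (Dbar q0) (m q0) v v =
        frechet_derivative (\<lambda>y. frechet_derivative (F q0) (at y) v) (at x0) v"
      unfolding F_eq x0_def
      by (rule riem_hessian_at_minimum) (use c zero nonneg in \<open>auto simp: inv\<close>)
    then show ?thesis using pos[OF c that] by simp
  qed
  obtain U R2 lo hi where U: "open U" "q0 \<in> U" "0 < R2" "0 < lo" "0 < hi"
    and growth: "\<forall>q\<in>U. \<forall>x\<in>ball x0 R2. \<forall>y\<in>ball x0 R2. F q y = 0 \<longrightarrow>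
       lo * (norm (x - y))\<^sup>2 \<le> F q x \<and> F q x \<le> hi * (norm (x - y))\<^sup>2"
    by (rule quadratic_growth_near_minimum[OF \<Omega> x0\<Omega> C2 _ hess]) (simp add: F_def nonneg)
  define N where "N = fst c \<inter> snd c -` ball x0 (min R1 R2)"
  have N: "open N" unfolding N_def
    using homeomorphism_cont1[OF hom] chart_open[OF atlas c(1)] by (intro continuous_open_preimage) auto
  have mN: "open (m -` N)" using N m by (rule open_vimage)
  have "open ((U \<inter> m -` N) \<times> N)" using U N mN by (intro open_Times open_Int)
  moreover have "m q0 \<in> N" using c U R1 by (simp add: N_def x0_def)
  then have "(q0, m q0) \<in> (U \<inter> m -` N) \<times> N" using U by simp
  \<comment> \<open>The first summand of the constant serves the upper bound, the second the lower
    bound.\<close>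
  moreover have "Dbar q z \<le> (hi * K\<^sup>2 + K\<^sup>2 / lo) * (dist z (m q))\<^sup>2 \<and>
      (dist z (m q))\<^sup>2 \<le> (hi * K\<^sup>2 + K\<^sup>2 / lo) * Dbar q z" if q: "q \<in> U" and N: "m q \<in> N" "z \<in> N" for q z
  proof -
    define x y where "x = snd c z" and "y = snd c (m q)"
    have xy: "chart_inv c x = z" "chart_inv c y = m q" using N inv by (auto simp: x_def y_def N_def)
    have balls: "x \<in> ball x0 R1" "y \<in> ball x0 R1" "x \<in> ball x0 R2" "y \<in> ball x0 R2"
      using N by (auto simp: N_def x_def y_def)
    have g: "lo * (norm (x - y))\<^sup>2 \<le> Dbar q z" "Dbar q z \<le> hi * (norm (x - y))\<^sup>2"
      using growth q balls(3,4) zero xy unfolding F_def by metis+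
    have d: "norm (x - y) \<le> K * dist z (m q)" "dist z (m q) \<le> K * norm (x - y)"
      using dist balls(1,2) xy by metis+
    have "Dbar q z \<le> hi * (norm (x - y))\<^sup>2" by (rule g)
    also have "\<dots> \<le> hi * (K * dist z (m q))\<^sup>2" using d U by (intro mult_left_mono power_mono) auto
    also have "\<dots> = hi * K\<^sup>2 * (dist z (m q))\<^sup>2" by (simp add: power_mult_distrib)
    also have "\<dots> \<le> (hi * K\<^sup>2 + K\<^sup>2 / lo) * (dist z (m q))\<^sup>2" using U by (intro mult_right_mono) auto
    finally have 1: "Dbar q z \<le> (hi * K\<^sup>2 + K\<^sup>2 / lo) * (dist z (m q))\<^sup>2" .
    have "(dist z (m q))\<^sup>2 \<le> (K * norm (x - y))\<^sup>2" using d by (intro power_mono) auto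
    also have "\<dots> = K\<^sup>2 / lo * (lo * (norm (x - y))\<^sup>2)" using U by (simp add: power_mult_distrib)
    also have "\<dots> \<le> K\<^sup>2 / lo * Dbar q z" using g U by (intro mult_left_mono) auto
    also have "\<dots> \<le> (hi * K\<^sup>2 + K\<^sup>2 / lo) * Dbar q z" using U nonneg by (intro mult_right_mono) auto
    finally show ?thesis using 1 by blast
  qed
  ultimately show ?thesis
    by (intro exI[of _ "(U \<inter> m -` N) \<times> N"] exI[of _ "hi * K\<^sup>2 + K\<^sup>2 / lo"]) auto
qed

theorem theorem3p2:
  fixes \<Theta> :: "real set" and \<theta>0 :: real
    and E :: "'q::topological_space \<Rightarrow> 'a \<Rightarrow> real \<Rightarrow> 'x measure"
    and MQ :: "'q measure" and MA :: "'a measure"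
    and score :: "'q \<Rightarrow> 'a \<Rightarrow> 'x \<Rightarrow> real"
    and I :: "'q \<Rightarrow> 'a \<Rightarrow> real" and Istar :: "'q \<Rightarrow> real"
    and \<psi> :: "'q \<Rightarrow> real \<Rightarrow> real" and b :: "'q \<Rightarrow> real"
    and D :: "'q \<Rightarrow> 'a \<Rightarrow> ereal"
    and qA :: "'a \<Rightarrow> 'm::metric_space"
    and Dbar :: "'q \<Rightarrow> 'm \<Rightarrow> real" and m :: "'q \<Rightarrow> 'm" and S :: "'m set"
    and A :: "('m, 'e::euclidean_space) chart set"
    and g :: "('m, 'e) chart \<Rightarrow> 'e \<Rightarrow> 'e \<Rightarrow> 'e \<Rightarrow> real"
  assumes interior: "\<theta>0 \<in> interior \<Theta>"
    and experiments: "\<And>q a. statistical_experiment \<Theta> (E q a)"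
    and dqm: "\<And>q a. dqm_at \<Theta> (E q a) \<theta>0 (score q a)"
    and fisher: "\<And>q a. I q a = fisher_information (E q a) \<theta>0 (score q a)"
    and spaces: "space MQ = UNIV" "space MA = UNIV"
    and blackwell: "\<And>F. (finite F \<and> F \<noteq> {}) \<or> F = UNIV \<Longrightarrow>
          \<exists>sel\<in>measurable MQ MA. \<forall>q. sel q \<in> F \<and> (\<forall>a\<in>F. blackwell_ge \<Theta> (E q (sel q)) (E q a))"
    and Istar_attained: "\<And>q. \<exists>a. I q a = Istar q"
    and Istar_upper: "\<And>q a. I q a \<le> Istar q"
    and Istar_pos: "\<And>q. Istar q > 0"
    and target: "\<And>q. (\<psi> q has_real_derivative b q) (at \<theta>0)"
    and D_def: "\<And>q a. D q a = distortion b I Istar q a"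
    and Q_compact: "compact (UNIV :: 'q set)"
    and M_compact: "compact (UNIV :: 'm set)"
    and qA_surj: "surj qA"
    and D_factor: "\<And>q a. D q a = ereal (Dbar q (qA a))"
    and Dbar_cont: "continuous_on UNIV (\<lambda>(q, z). Dbar q z)"
    and Dbar_nonneg: "\<And>q z. 0 \<le> Dbar q z"
    and oracle_class: "\<And>q z. Dbar q z = 0 \<longleftrightarrow> z = m q"
    and S_def: "S = range m"
    and atlas: "smooth_atlas A"
    and S_covered: "S \<subseteq> \<Union> (fst ` A)"
    and metric: "riemannian_metric A g"
    and dist_geodesic: "dist_geodesic_near A g S"
    and Dbar_C3: "C3_near_graph A Dbar m"
    and gradient_zero: "\<And>q c. c \<in> A \<Longrightarrow> m q \<in> fst c \<Longrightarrow> riem_gradient g c (Dbar q) (m q) = 0"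
    and hessian_pos: "\<And>q c v. c \<in> A \<Longrightarrow> m q \<in> fst c \<Longrightarrow> v \<noteq> 0 \<Longrightarrow>
          riem_hessian g c (Dbar q) (m q) v v > 0"
    and eigenvalues: "\<exists>lo hi. 0 < lo \<and> (\<forall>q. \<forall>c\<in>A. \<forall>lam. m q \<in> fst c \<longrightarrow>
          form_eigenvalue (g c (snd c (m q))) (riem_hessian g c (Dbar q) (m q)) lam \<longrightarrow>
          lo \<le> lam \<and> lam \<le> hi)"
    and separated: "\<And>\<epsilon>. \<epsilon> > 0 \<Longrightarrow> separation Dbar m \<epsilon> > 0"
  shows "(\<exists>cD CD. 0 < cD \<and> cD \<le> CD \<and>
            (\<forall>\<^sub>F k in sequentially.
               ereal cD * (covering_radius S k)\<^sup>2 \<le> frontier_value D k \<and>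
               frontier_value D k \<le> ereal CD * (covering_radius S k)\<^sup>2)) \<and>
         (\<forall>r>0. ahlfors_regular S r \<longrightarrow>
            (\<exists>c C. 0 < c \<and> c \<le> C \<and>
               (\<forall>\<^sub>F k in sequentially.
                  ereal c \<le> frontier_value D k / ereal (real k powr (- 2 / r)) \<and>
                  frontier_value D k / ereal (real k powr (- 2 / r)) \<le> ereal C)))"
proof -
  have zero: "Dbar q (m q) = 0" for q using oracle_class by blast
  have m: "continuous_on UNIV m" using Dbar_cont zero separated by (rule separated_minimizer_continuous)
  \<comment> \<open>Distortion and squared distance are compared as functions on the compact product
    space.\<close>
  define f where "f = (\<lambda>(q, z). Dbar q z)"
  define h where "h = (\<lambda>(q, z). (dist z (m q))\<^sup>2)"
  have nonneg: "0 \<le> f w" "0 \<le> h w" for w by (auto simp: f_def h_def Dbar_nonneg split: prod.split)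
  have fcont: "continuous_on UNIV f" using Dbar_cont by (simp add: f_def)
  have hcont: "continuous_on UNIV h" unfolding h_def split_def
    by (intro continuous_intros continuous_on_compose2[OF m]) auto
  have "compact (UNIV :: ('q \<times> 'm) set)" using compact_Times[OF Q_compact M_compact] by simp
  then obtain C where C: "1 \<le> C" "\<And>w. f w \<le> C * h w" "\<And>w. h w \<le> C * f w"
  proof (rule locally_comparable_imp_comparable[of f h])
    fix w :: "'q \<times> 'm"
    obtain q z where w: "w = (q, z)" by (cases w)
    show "\<exists>U C. open U \<and> w \<in> U \<and> (\<forall>w\<in>U. f w \<le> C * h w \<and> h w \<le> C * f w)"
    \<comment> \<open>On the graph both functions vanish and the Hessian decides; off the graph both
      are positive.\<close>
    proof (cases "z = m q")
      case True
      obtain U C where "open U" "(q, m q) \<in> U" "\<forall>(q, z)\<in>U.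
          Dbar q z \<le> C * (dist z (m q))\<^sup>2 \<and> (dist z (m q))\<^sup>2 \<le> C * Dbar q z"
        using distortion_comparable_near_graph[of Dbar m A g q, OF Dbar_nonneg zero m
            S_covered[unfolded S_def] atlas metric dist_geodesic[unfolded S_def] Dbar_C3 hessian_pos] by blast
      then show ?thesis using True w by (intro exI[of _ U] exI[of _ C]) (auto simp: f_def h_def)
    next
      case False
      then have "0 < f w" "0 < h w"
        using oracle_class[of q z] Dbar_nonneg[of q z] by (auto simp: f_def h_def w less_le)
      with fcont hcont show ?thesis using nonneg by (intro locally_comparable_if_positive)
    qed
  qed (use nonneg in auto)
  have comparable: "\<exists>u v. 0 \<le> u \<and> 0 \<le> v \<and> frontier_value D k = ereal u \<and> covering_radius S k = ereal v \<and>
      u \<le> C * v\<^sup>2 \<and> v\<^sup>2 \<le> C * u" if "1 \<le> k" for k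
  proof (rule frontier_value_comparable[of C k qA D Dbar m])
    show "Dbar q z \<le> C * (dist z (m q))\<^sup>2" "(dist z (m q))\<^sup>2 \<le> C * Dbar q z" for q z
      using C(2,3)[of "(q, z)"] by (auto simp: f_def h_def)
  qed (use C that M_compact qA_surj D_factor Dbar_nonneg S_def in auto)
  show ?thesis
  proof (intro conjI allI impI)
    have "\<forall>\<^sub>F k in sequentially. ereal (1 / C) * (covering_radius S k)\<^sup>2 \<le> frontier_value D k \<and>
        frontier_value D k \<le> ereal C * (covering_radius S k)\<^sup>2"
      using eventually_ge_at_top[of 1]
    proof eventually_elim
      case (elim k)
      then obtain u v where "frontier_value D k = ereal u" "covering_radius S k = ereal v"
        "u \<le> C * v\<^sup>2" "v\<^sup>2 \<le> C * u" using comparable by blast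
      then show ?case using C(1) by (simp add: field_simps)
    qed
    moreover have "0 < 1 / C" "1 / C \<le> C" using C(1) by (auto simp: field_simps intro: order_trans[of _ C])
    ultimately show "\<exists>cD CD. 0 < cD \<and> cD \<le> CD \<and> (\<forall>\<^sub>F k in sequentially.
        ereal cD * (covering_radius S k)\<^sup>2 \<le> frontier_value D k \<and>
        frontier_value D k \<le> ereal CD * (covering_radius S k)\<^sup>2)" by blast
  next
    fix r :: real assume r: "r > 0" and "ahlfors_regular S r"
    then obtain \<mu> c0 C0 R0 where \<mu>: "sets \<mu> = sets (restrict_space borel S)" "0 < c0" "c0 \<le> C0" "R0 > 0"
      "\<And>s R. s \<in> S \<Longrightarrow> 0 < R \<Longrightarrow> R < R0 \<Longrightarrow> ennreal (c0 * R powr r) \<le> emeasure \<mu> (S \<inter> ball s R)"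
      "\<And>s R. s \<in> S \<Longrightarrow> 0 < R \<Longrightarrow> R < R0 \<Longrightarrow> emeasure \<mu> (S \<inter> ball s R) \<le> ennreal (C0 * R powr r)"
      unfolding ahlfors_regular_def by blast
    have "S \<noteq> {}" using S_def by blast
    obtain \<kappa> where \<kappa>: "0 < \<kappa>"
      "\<And>k. 1 \<le> k \<Longrightarrow> ereal (\<kappa> * real k powr (- 1 / r)) \<le> covering_radius S k"
      using Ahlfors_covering_lower[OF \<mu>(1) \<open>S \<noteq> {}\<close> r \<mu>(2-6)] by blast
    obtain K where K: "0 < K"
      "\<forall>\<^sub>F k in sequentially. covering_radius S k \<le> ereal (K * real k powr (- 1 / r))"
      using Ahlfors_covering_upper[OF \<mu>(1) \<open>S \<noteq> {}\<close> r \<mu>(2-6) M_compact] by blast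
    \<comment> \<open>The bounds for the covering radius are squared and combined with the
      comparison constant \<open>C\<close>. The extra summand \<open>\<kappa>\<^sup>2 / C\<close> on
      the right makes the order of the two constants immediate.\<close>
    have "\<forall>\<^sub>F k in sequentially.
        ereal (\<kappa>\<^sup>2 / C) \<le> frontier_value D k / ereal (real k powr (- 2 / r)) \<and>
        frontier_value D k / ereal (real k powr (- 2 / r)) \<le> ereal (C * K\<^sup>2 + \<kappa>\<^sup>2 / C)"
      using K(2) eventually_ge_at_top[of 1]
    proof eventually_elim
      case (elim k)
      then obtain u v where uv: "0 \<le> v" "frontier_value D k = ereal u" "covering_radius S k = ereal v"
        "u \<le> C * v\<^sup>2" "v\<^sup>2 \<le> C * u" using comparable by blast
      define t where "t = real k powr (- 1 / r)"
      have t: "0 < t" using elim by (simp add: t_def)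
      have t2: "real k powr (- 2 / r) = t\<^sup>2"
        by (simp add: t_def power2_eq_square flip: powr_add)
      have "\<kappa> * t \<le> v" "v \<le> K * t" using \<kappa>(2)[of k] elim uv by (auto simp: t_def)
      then have v: "\<kappa>\<^sup>2 * t\<^sup>2 \<le> v\<^sup>2" "v\<^sup>2 \<le> K\<^sup>2 * t\<^sup>2"
        using power_mono[of "\<kappa> * t" v 2] power_mono[of v "K * t" 2] \<kappa> t uv(1)
        by (auto simp: power_mult_distrib)
      have "\<kappa>\<^sup>2 / C \<le> u / t\<^sup>2" using v(1) uv(5) t C(1) by (simp add: field_simps)
      moreover have "u \<le> C * (K\<^sup>2 * t\<^sup>2)" using uv(4) mult_left_mono[OF v(2), of C] C(1) by linarith
      then have "u / t\<^sup>2 \<le> C * K\<^sup>2" using t by (simp add: field_simps)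
      moreover have "0 \<le> \<kappa>\<^sup>2 / C" using C(1) by simp
      ultimately show ?case unfolding uv(2) t2 using t by simp
    qed
    moreover have "0 < \<kappa>\<^sup>2 / C" "\<kappa>\<^sup>2 / C \<le> C * K\<^sup>2 + \<kappa>\<^sup>2 / C" using \<kappa> C(1) by auto
    ultimately show "\<exists>c C. 0 < c \<and> c \<le> C \<and> (\<forall>\<^sub>F k in sequentially.
        ereal c \<le> frontier_value D k / ereal (real k powr (- 2 / r)) \<and>
        frontier_value D k / ereal (real k powr (- 2 / r)) \<le> ereal C)" by blast
  qed
qed

end
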